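(* Consider a sequence, indexed by $N\geq 1$, of Biorthogonal Ensembles satisfying the structural assumption (both described in the context). Assume there exists $\varepsilon>0$ such that for every integer $n\geq 1$, $$W_N:=\max_{k,m\in\mathbb N:\ \left|\frac kN-1\right|\leq\varepsilon,\ \left|\frac mN-1\right|\leq\varepsilon}\left|\langle xP_{k,N},Q_{m,N}\rangle_{L^2(\mu_N)}\right|=o(N^{1/n})\qquad\text{as }N\to\infty .$$ Then for every $0<\alpha<1$ and any $\ell\in\mathbb N$, there exists a constant $C_{\alpha,\ell}$ independent of $N$ such that $$\mathbb V\mathrm{ar}\left[\int x^\ell\,\hat\mu^N(\mathrm dx)\right]\leq\frac{C_{\alpha,\ell}}{N^{1+\alpha}} .$$ If moreover the sequences $(\mathfrak q_N)_{N\ge 1}$ and $(W_N)_{N\ge1}$ are bounded, then the same inequality also holds for $\alpha=1$ (that is, for any $\ell\in\mathbb N$ there is $C_{1,\ell}$ independent of $N$ such that the variance is at most $C_{1,\ell}/N^2$).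
   Context: $\mathbb N=\{0,1,2,\dots\}$. All functions are real-valued and $\langle f,g\rangle_{L^2(\mu)}=\int fg\,\mathrm d\mu$. Biorthogonal Ensemble: for each $N\ge1$ let $\mu_N$ be a Borel measure on $\mathbb R$ and $(P_{k,N})_{k=0}^{N-1}$, $(Q_{k,N})_{k=0}^{N-1}$ two families in $L^2(\mu_N)$ with $\langle P_{k,N},Q_{m,N}\rangle_{L^2(\mu_N)}=\delta_{km}$ for $0\le k,m\le N-1$, such that $$\frac1{N!}\det\big[P_{k-1,N}(x_i)\big]_{i,k=1}^N\det\big[Q_{k-1,N}(x_i)\big]_{i,k=1}^N\prod_{i=1}^N\mu_N(\mathrm dx_i)$$ is a probability measure on $\mathbb R^N$. The real random variables $x_1,\dots,x_N$ (depending on $N$) have this joint distribution, and $\mathbb V\mathrm{ar}$ denotes the variance with respect to it. Structural assumption: (a) for each $N$, the two families can be completed into infinite families $(P_{k,N})_{k\in\mathbb N}$, $(Q_{k,N})_{k\in\mathbb N}$ of $L^2(\mu_N)$ with $\langle P_{k,N},Q_{m,N}\rangle_{L^2(\mu_N)}=\delta_{km}$ for all $k,m\in\mathbb N$ (these completed families are fixed); (b) there is a sequence $(\mathfrak q_N)_{N\ge1}$ of nonnegative integers such that for every integer $n\ge1$, $\mathfrak q_N=o(N^{1/n})$ as $N\to\infty$, and for all $N\ge 1$, $k\in\mathbb N$, the function $x\mapsto xP_{k,N}(x)$ belongs to $\mathrm{Span}(P_{m,N})_{m=0}^{k+\mathfrak q_N}$. Empirical measure: $\hat\mu^N=\frac1N\sum_{i=1}^N\delta_{x_i}$.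 *)

theory Defs
  imports
    "HOL-Probability.Probability"
    "HOL-Library.Landau_Symbols"
    "Jordan_Normal_Form.Determinant"
begin

definition in_L2 :: "'a measure \<Rightarrow> ('a \<Rightarrow> real) \<Rightarrow> bool" where
  "in_L2 M f \<longleftrightarrow> f \<in> borel_measurable M \<and> integrable M (\<lambda>x. (f x)\<^sup>2)"

definition L2_inner :: "'a measure \<Rightarrow> ('a \<Rightarrow> real) \<Rightarrow> ('a \<Rightarrow> real) \<Rightarrow> real" where
  "L2_inner M f g = (\<integral>x. f x * g x \<partial>M)"

definition biorthogonal_families ::
    "nat set \<Rightarrow> real measure \<Rightarrow> (nat \<Rightarrow> real \<Rightarrow> real) \<Rightarrow> (nat \<Rightarrow> real \<Rightarrow> real) \<Rightarrow> bool" where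
  "biorthogonal_families K M P Q \<longleftrightarrow>
     (\<forall>k\<in>K. in_L2 M (P k) \<and> in_L2 M (Q k)) \<and>
     (\<forall>k\<in>K. \<forall>m\<in>K. L2_inner M (P k) (Q m) = (if k = m then 1 else 0))"

text \<open>
  Points of $\mathbb R^N$ are functions on the index set \<open>{..<N}\<close>, so the coordinates
  \<open>x 0, \<dots>, x (N - 1)\<close> are the particles $x_1, \dots, x_N$.
\<close>

definition ensemble_density ::
    "nat \<Rightarrow> (nat \<Rightarrow> real \<Rightarrow> real) \<Rightarrow> (nat \<Rightarrow> real \<Rightarrow> real) \<Rightarrow> (nat \<Rightarrow> real) \<Rightarrow> real" where
  "ensemble_density N P Q x =
     1 / fact N * Determinant.det (Matrix.mat N N (\<lambda>(i, k). P k (x i)))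
                * Determinant.det (Matrix.mat N N (\<lambda>(i, k). Q k (x i)))"

definition ensemble_law ::
    "nat \<Rightarrow> real measure \<Rightarrow> (nat \<Rightarrow> real \<Rightarrow> real) \<Rightarrow> (nat \<Rightarrow> real \<Rightarrow> real) \<Rightarrow> (nat \<Rightarrow> real) measure" where
  "ensemble_law N M P Q =
     density (PiM {..<N} (\<lambda>_. M)) (\<lambda>x. ennreal (ensemble_density N P Q x))"

text \<open>
  Since \<^const>\<open>ennreal\<close> sends negative reals to \<open>0\<close>, the law by itself only sees the positive
  part of the signed density; nonnegativity almost everywhere is therefore a separate conjunct.
\<close>

definition biorthogonal_ensemble ::
    "nat \<Rightarrow> real measure \<Rightarrow> (nat \<Rightarrow> real \<Rightarrow> real) \<Rightarrow> (nat \<Rightarrow> real \<Rightarrow> real) \<Rightarrow> bool" where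
  "biorthogonal_ensemble N M P Q \<longleftrightarrow>
     sets M = sets borel \<and>
     biorthogonal_families {..<N} M P Q \<and>
     (AE x in PiM {..<N} (\<lambda>_. M). 0 \<le> ensemble_density N P Q x) \<and>
     prob_space (ensemble_law N M P Q)"

text \<open>
  The span condition is an identity between elements of $L^2(\mu_N)$, i.e.\ it holds almost everywhere.
\<close>

definition structural_assumption ::
    "(nat \<Rightarrow> real measure) \<Rightarrow> (nat \<Rightarrow> nat \<Rightarrow> real \<Rightarrow> real) \<Rightarrow> (nat \<Rightarrow> nat \<Rightarrow> real \<Rightarrow> real) \<Rightarrow>
     (nat \<Rightarrow> nat) \<Rightarrow> bool" where
  "structural_assumption \<mu> P Q q \<longleftrightarrow>
     (\<forall>N\<ge>1. biorthogonal_families UNIV (\<mu> N) (P N) (Q N)) \<and>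
     (\<forall>n::nat\<ge>1. (\<lambda>N. real (q N)) \<in> o(\<lambda>N. real N powr (1 / real n))) \<and>
     (\<forall>N\<ge>1. \<forall>k. \<exists>c :: nat \<Rightarrow> real.
        AE x in \<mu> N. x * P N k x = (\<Sum>m\<le>k + q N. c m * P N m x))"

definition window_max ::
    "real \<Rightarrow> nat \<Rightarrow> real measure \<Rightarrow> (nat \<Rightarrow> real \<Rightarrow> real) \<Rightarrow> (nat \<Rightarrow> real \<Rightarrow> real) \<Rightarrow> real" where
  "window_max \<epsilon> N M P Q =
     Max {\<bar>L2_inner M (\<lambda>x. x * P k x) (Q m)\<bar> | k m.
            \<bar>real k / real N - 1\<bar> \<le> \<epsilon> \<and> \<bar>real m / real N - 1\<bar> \<le> \<epsilon>}"

definition empirical_measure :: "nat \<Rightarrow> (nat \<Rightarrow> real) \<Rightarrow> real measure" where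
  "empirical_measure N x =
     measure_of UNIV (sets borel)
       (\<lambda>A. ennreal (1 / real N) * (\<Sum>i<N. emeasure (return borel (x i)) A))"

lemma measure_space_empirical:
  fixes x :: "nat \<Rightarrow> real"
  shows "measure_space UNIV (sets borel)
     (\<lambda>A. ennreal (1 / real N) * (\<Sum>i<N. emeasure (return borel (x i)) A))"
proof -
  have "countably_additive (sets borel)
     (\<lambda>A. ennreal (1 / real N) * (\<Sum>i<N. emeasure (return borel (x i)) A))"
  proof (rule countably_additiveI)
    fix A :: "nat \<Rightarrow> real set"
    assume A: "range A \<subseteq> sets borel" "disjoint_family A"
    have eq: "(\<Sum>n. emeasure (return borel (x i)) (A n)) = emeasure (return borel (x i)) (\<Union>n. A n)" for i
      using A by (intro suminf_emeasure) auto
    have "(\<Sum>n. ennreal (1 / real N) * (\<Sum>i<N. emeasure (return borel (x i)) (A n)))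
        = ennreal (1 / real N) * (\<Sum>i<N. \<Sum>n. emeasure (return borel (x i)) (A n))"
      by (simp add: suminf_sum)
    also have "\<dots> = ennreal (1 / real N) * (\<Sum>i<N. emeasure (return borel (x i)) (\<Union>n. A n))"
      by (simp only: eq)
    finally show "(\<Sum>n. ennreal (1 / real N) * (\<Sum>i<N. emeasure (return borel (x i)) (A n)))
        = ennreal (1 / real N) * (\<Sum>i<N. emeasure (return borel (x i)) (\<Union> (range A)))" .
  qed
  then show ?thesis
    unfolding measure_space_def
    by (auto simp: positive_def sets.sigma_algebra_axioms[of borel, simplified])
qed

lemma sets_empirical_measure [simp]: "sets (empirical_measure N x) = sets borel"
  and space_empirical_measure [simp]: "space (empirical_measure N x) = UNIV"
  using sets.sigma_sets_eq[of "borel :: real measure"]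
  by (simp_all add: empirical_measure_def)

lemma emeasure_empirical_measure:
  assumes "A \<in> sets borel"
  shows "emeasure (empirical_measure N x) A
           = ennreal (1 / real N) * (\<Sum>i<N. emeasure (return borel (x i)) A)"
  using measure_space_empirical[of N x] assms
  by (intro emeasure_measure_of[OF empirical_measure_def[of N x]])
     (auto simp: measure_space_def)

definition empirical_moment :: "nat \<Rightarrow> nat \<Rightarrow> (nat \<Rightarrow> real) \<Rightarrow> real" where
  "empirical_moment N l x = (\<integral>t. t ^ l \<partial>empirical_measure N x)"

lemma empirical_measure_eq_distr:
  assumes "N \<ge> 1"
  shows "empirical_measure N x = distr (uniform_count_measure {..<N}) borel x"
proof (rule measure_eqI)
  fix A assume "A \<in> sets (empirical_measure N x)"
  then have A: "A \<in> sets borel" by simp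
  have "emeasure (empirical_measure N x) A = ennreal (1 / real N) * (\<Sum>i<N. indicator A (x i))"
    using A by (simp add: emeasure_empirical_measure)
  also have "(\<Sum>i<N. indicator A (x i)) = (of_nat (card {i\<in>{..<N}. x i \<in> A}) :: ennreal)"
    by (simp add: indicator_def sum.If_cases Int_def)
  also have "ennreal (1 / real N) * of_nat (card {i\<in>{..<N}. x i \<in> A})
      = ennreal (real (card {i\<in>{..<N}. x i \<in> A}) / real N)"
    by (simp add: ennreal_of_nat_eq_real_of_nat ennreal_mult[symmetric])
  also have "\<dots> = emeasure (uniform_count_measure {..<N}) {i\<in>{..<N}. x i \<in> A}"
    by (subst emeasure_uniform_count_measure) (auto simp: divide_ennreal)
  also have "\<dots> = emeasure (distr (uniform_count_measure {..<N}) borel x) A"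
    using A by (subst emeasure_distr)
      (auto simp: space_uniform_count_measure vimage_def Int_def conj_commute
        measurable_def sets_uniform_count_measure
        intro!: arg_cong[where f = "emeasure (uniform_count_measure {..<N})"])
  finally show "emeasure (empirical_measure N x) A
      = emeasure (distr (uniform_count_measure {..<N}) borel x) A" .
qed simp

lemma empirical_moment_eq:
  assumes "N \<ge> 1"
  shows "empirical_moment N l x = 1 / real N * (\<Sum>i<N. x i ^ l)"
proof -
  have "x \<in> uniform_count_measure {..<N} \<rightarrow>\<^sub>M borel"
    by (auto simp: measurable_def sets_uniform_count_measure space_uniform_count_measure)
  then show ?thesis
    unfolding empirical_moment_def empirical_measure_eq_distr[OF assms]
    by (simp add: integral_distr integral_uniform_count_measure)
qed

text \<open>
  The Bochner integral of a non-integrable function is \<open>0\<close>, so a bound on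
  \<^term>\<open>prob_space.variance M X\<close> is meaningful only together with square integrability.
\<close>

definition has_variance_le :: "'a measure \<Rightarrow> ('a \<Rightarrow> real) \<Rightarrow> real \<Rightarrow> bool" where
  "has_variance_le M X b \<longleftrightarrow> in_L2 M X \<and> prob_space.variance M X \<le> b"

end

theory Submission
  imports Defs
begin

text \<open>
  The variance of a linear statistic of a biorthogonal ensemble is a boundary effect at the index
  \<open>N\<close>. Write $A = (\langle x^l P_k, Q_m\rangle)_{k,m}$ for the matrix of multiplication by $x^l$.
  Expanding both determinants over permutations and integrating term by term expresses the first two
  moments of $\sum_i x_i^l$ through $A$, with the outcome
  $$\mathrm{Var}\Big[\sum_i x_i^l\Big] = \sum_{k<N} (A^2)_{kk} - \sum_{k,m<N} A_{km}A_{mk}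
  = \sum_{k<N\le m} A_{km}A_{mk}$$
  (\<open>linear_statistic_variance\<close>, \<open>variance_as_boundary_sum\<close>); here $\langle x^{2l}P_k,Q_k\rangle$
  is an entry of $A^2$ because $x^lP_k$ is a finite combination of the $P_j$.
  
  Now $A$ is the $l$-th power of the one-step matrix $J = (\langle xP_k,Q_m\rangle)_{k,m}$, which
  vanishes for $m > k + q$. Hence $A_{km}$ vanishes for $m > k + lq$, so the boundary sum has at most
  $(lq)^2$ terms. Each $A_{km}$ in it is a sum over paths of length $l$. There is no control on how far
  a single step may descend, but a path can climb by at most $q$ per step, and so a path which returns
  to the neighbourhood of $N$ never leaves it: all its vertices lie within $2lq$ of $N$
  (\<open>moment_bound\<close>). Once $2lq \le \min(\varepsilon,1) N$, every factor along the path is at most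
  $W_N$, and
  $$\mathrm{Var}\Big[\frac1N\sum_i x_i^l\Big] \le \frac{(lq)^2\,((4lq+1)W_N)^{2l}}{N^2}$$
  (\<open>empirical_moment_variance\<close>). The numerator is bounded if $q$ and $W_N$ are, and it is below any
  positive power of $N$ if $q$ and $W_N$ are.
  
  The reference measures are arbitrary Borel measures, while Fubini's theorem requires
  $\sigma$-finiteness. Therefore each measure is first restricted to the set where some member of the
  two families is nonzero (\<open>ensemble_restrict_to_support\<close>).
\<close>

section \<open>Square-integrable functions\<close>

lemma in_L2_integrable_mult:
  assumes "in_L2 M f" "in_L2 M g"
  shows "integrable M (\<lambda>x. f x * g x)"
proof (rule Bochner_Integration.integrable_bound)
  show "integrable M (\<lambda>x. (f x)\<^sup>2 + (g x)\<^sup>2)"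
    using assms by (auto simp: in_L2_def)
  show "(\<lambda>x. f x * g x) \<in> borel_measurable M"
    using assms by (auto simp: in_L2_def)
  have "\<bar>a * b\<bar> \<le> a\<^sup>2 + b\<^sup>2" for a b :: real
  proof -
    have "0 \<le> (\<bar>a\<bar> - \<bar>b\<bar>)\<^sup>2" by simp
    also have "\<dots> = a\<^sup>2 + b\<^sup>2 - 2 * \<bar>a * b\<bar>" by (simp add: power2_diff abs_mult)
    finally show ?thesis by simp
  qed
  then show "AE x in M. norm (f x * g x) \<le> norm ((f x)\<^sup>2 + (g x)\<^sup>2)"
    by (intro AE_I2) simp
qed

lemma in_L2_sum:
  assumes "\<And>i. i \<in> I \<Longrightarrow> in_L2 M (f i)"
  shows "in_L2 M (\<lambda>x. \<Sum>i\<in>I. f i x)"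
proof -
  have "integrable M (\<lambda>x. \<Sum>i\<in>I. \<Sum>j\<in>I. f i x * f j x)"
    by (intro Bochner_Integration.integrable_sum in_L2_integrable_mult assms)
  moreover have "(\<lambda>x. \<Sum>i\<in>I. f i x) \<in> borel_measurable M"
    using assms by (intro borel_measurable_sum) (simp add: in_L2_def)
  ultimately show ?thesis
    by (simp add: in_L2_def power2_eq_square sum_product)
qed

lemma in_L2_scale:
  assumes "in_L2 M f" shows "in_L2 M (\<lambda>x. c * f x)"
  using assms by (auto simp: in_L2_def power_mult_distrib)

lemma in_L2_cong_AE:
  assumes "in_L2 M g" "f \<in> borel_measurable M" "AE x in M. f x = g x"
  shows "in_L2 M f"
proof -
  have "integrable M (\<lambda>x. (f x)\<^sup>2) \<longleftrightarrow> integrable M (\<lambda>x. (g x)\<^sup>2)"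
    using assms by (intro integrable_cong_AE) (auto simp: in_L2_def)
  then show ?thesis using assms by (auto simp: in_L2_def)
qed

section \<open>The density as a double sum over permutations\<close>

lemma det_mat_permutes:
  fixes F :: "nat \<Rightarrow> 'a \<Rightarrow> 'b::comm_ring_1"
  shows "Determinant.det (Matrix.mat N N (\<lambda>(i, k). F k (x i)))
    = (\<Sum>p | p permutes {..<N}. of_int (sign p) * (\<Prod>i<N. F (p i) (x i)))"
proof -
  have "(\<Prod>i<N. Matrix.mat N N (\<lambda>(i, k). F k (x i)) $$ (i, p i)) = (\<Prod>i<N. F (p i) (x i))"
    if "p permutes {..<N}" for p
    using permutes_in_image[OF that] by (intro prod.cong) auto
  then show ?thesis
    by (simp add: Determinant.det_def lessThan_atLeast0)
qed

lemma ensemble_density_permutes: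
  "ensemble_density N P Q x = (\<Sum>\<sigma> | \<sigma> permutes {..<N}. \<Sum>\<tau> | \<tau> permutes {..<N}.
     (1 / fact N * of_int (sign \<sigma>) * of_int (sign \<tau>)) * (\<Prod>i<N. P (\<sigma> i) (x i) * Q (\<tau> i) (x i)))"
  unfolding ensemble_density_def det_mat_permutes
  by (simp add: sum_product prod.distrib sum_distrib_left sum_distrib_right mult_ac)

lemma ensemble_density_measurable:
  assumes "\<And>k. k < N \<Longrightarrow> P k \<in> borel_measurable M" "\<And>k. k < N \<Longrightarrow> Q k \<in> borel_measurable M"
  shows "ensemble_density N P Q \<in> borel_measurable (PiM {..<N} (\<lambda>_. M))"
proof -
  have m: "(\<lambda>x. F (p i) (x i)) \<in> borel_measurable (PiM {..<N} (\<lambda>_. M))"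
    if "p permutes {..<N}" "i < N" "\<And>k. k < N \<Longrightarrow> F k \<in> borel_measurable M"
    for p i and F :: "nat \<Rightarrow> real \<Rightarrow> real"
  proof -
    have [measurable]: "F (p i) \<in> borel_measurable M"
      using that permutes_in_image[OF that(1), of i] by auto
    show ?thesis
      using that(2) by (intro measurable_compose[OF measurable_component_singleton]) auto
  qed
  show ?thesis
    unfolding ensemble_density_permutes[abs_def]
    using assms by (intro borel_measurable_sum borel_measurable_times borel_measurable_prod
        borel_measurable_const m) auto
qed

lemma ensemble_density_outside:
  assumes "i < N" "\<And>k. P k (x i) = 0"
  shows "ensemble_density N P Q x = 0"
  unfolding ensemble_density_permutes
  using assms by (intro sum.neutral ballI) (auto intro!: prod_zero)

section \<open>Reduction to a sigma-finite reference measure\<close>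

text \<open>
  The product of measures that are not $\sigma$-finite is an arbitrary extension of the
  rectangle formula when an extension exists, and the null measure otherwise. A product that
  charges some set is therefore of the first kind.
\<close>
lemma PiM_rectangle_if_not_null:
  assumes I: "finite I" and nn: "emeasure (PiM I M) X \<noteq> 0"
    and A: "\<And>i. i \<in> I \<Longrightarrow> A i \<in> sets (M i)"
  shows "emeasure (PiM I M) (Pi\<^sub>E I A) = (\<Prod>i\<in>I. emeasure (M i) (A i))"
proof -
  let ?\<Omega> = "\<Pi>\<^sub>E i\<in>I. space (M i)"
  let ?J = "{(J, X). (J \<noteq> {} \<or> I = {}) \<and> finite J \<and> J \<subseteq> I \<and> X \<in> (\<Pi> j\<in>J. sets (M j))}"
  let ?G = "\<lambda>(J, X). prod_emb I M J (\<Pi>\<^sub>E j\<in>J. X j)"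
  let ?v = "\<lambda>(J, X). \<Prod>j\<in>J \<union> {i\<in>I. emeasure (M i) (space (M i)) \<noteq> 1}.
     if j \<in> J then emeasure (M j) (X j) else emeasure (M j) (space (M j))"
  have sub: "?G ` ?J \<subseteq> Pow ?\<Omega>"
    by (auto simp: prod_emb_def)
  have ex: "\<exists>\<mu>'. (\<forall>i\<in>?J. \<mu>' (?G i) = ?v i) \<and> measure_space ?\<Omega> (sigma_sets ?\<Omega> (?G ` ?J)) \<mu>'"
  proof (rule ccontr)
    assume "\<not> ?thesis"
    then have "PiM I M = measure_of ?\<Omega> (?G ` ?J) (\<lambda>_. 0)"
      unfolding PiM_def extend_measure_def by (simp only: simp_thms if_False)
    then have "emeasure (PiM I M) X = 0"
      by (simp add: emeasure_sigma)
    with nn show False by simp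
  qed
  then obtain \<mu>' where \<mu>': "\<And>i. i \<in> ?J \<Longrightarrow> \<mu>' (?G i) = ?v i"
    and ms: "measure_space ?\<Omega> (sigma_sets ?\<Omega> (?G ` ?J)) \<mu>'"
    by blast
  have s: "sets (PiM I M) = sigma_sets ?\<Omega> (?G ` ?J)"
    unfolding PiM_def by (rule sets_extend_measure[OF sub])
  have "(I, A) \<in> ?J"
    using I A by auto
  then have "emeasure (PiM I M) (?G (I, A)) = ?v (I, A)"
    using ms unfolding measure_space_def s[symmetric]
    by (intro emeasure_extend_measure[OF PiM_def \<mu>' sub]) blast+
  moreover have "?G (I, A) = Pi\<^sub>E I A"
    using A by (simp add: prod_emb_PiE_same_index sets.sets_into_space)
  moreover have "?v (I, A) = (\<Prod>i\<in>I. emeasure (M i) (A i))"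
    by (auto intro!: prod.cong)
  ultimately show ?thesis by simp
qed

text \<open>
  Functions in $L^2$ live on a $\sigma$-finite set, because their level sets have finite measure,
  and the ensemble density vanishes as soon as one particle leaves the set where some member of the
  families is nonzero. Restricting \<open>M\<close> to this set changes neither the law nor any of the inner
  products, and makes Fubini's theorem available.
\<close>
definition joint_support :: "(nat \<Rightarrow> real \<Rightarrow> real) \<Rightarrow> (nat \<Rightarrow> real \<Rightarrow> real) \<Rightarrow> real set" where
  "joint_support P Q = {x. \<exists>k. P k x \<noteq> 0 \<or> Q k x \<noteq> 0}"

definition restrict_to_support where
  "restrict_to_support M P Q = density M (indicator (joint_support P Q))"

lemma joint_support_measurable:
  assumes "sets M = sets borel" "biorthogonal_families UNIV M P Q"
  shows "joint_support P Q \<in> sets M"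
proof -
  have [measurable]: "P k \<in> borel_measurable M" "Q k \<in> borel_measurable M" for k
    using assms by (auto simp: biorthogonal_families_def in_L2_def)
  have "joint_support P Q = {x\<in>space M. \<exists>k. P k x \<noteq> 0 \<or> Q k x \<noteq> 0}"
    using assms(1)[THEN sets_eq_imp_space_eq] by (auto simp: joint_support_def)
  then show ?thesis by simp
qed

lemma in_L2_level_set_finite:
  assumes "in_L2 M f" "0 < (c::real)"
  shows "emeasure M {x\<in>space M. c \<le> (f x)\<^sup>2} \<noteq> \<infinity>"
proof -
  have "emeasure M {x\<in>space M. c \<le> (f x)\<^sup>2} \<le> ennreal (1 / c * (\<integral>x. (f x)\<^sup>2 \<partial>M))"
    using assms by (intro integral_Markov_inequality) (auto simp: in_L2_def)
  then show ?thesis by (auto simp: top_unique)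
qed

lemma sigma_finite_restrict_to_support:
  assumes M: "sets M = sets borel" and bio: "biorthogonal_families UNIV M P Q"
  shows "sigma_finite_measure (restrict_to_support M P Q)"
proof
  let ?S = "joint_support P Q" and ?M = "restrict_to_support M P Q"
  have S: "?S \<in> sets M" using joint_support_measurable[OF assms] .
  have L2: "in_L2 M (P k)" "in_L2 M (Q k)" for k
    using bio by (auto simp: biorthogonal_families_def)
  then have [measurable]: "P k \<in> borel_measurable M" "Q k \<in> borel_measurable M" for k
    by (auto simp: in_L2_def)
  define L where "L = (\<lambda>(k, n, b). {x\<in>space M. 1 / real (Suc n) \<le> ((if b then P k else Q k) x)\<^sup>2})"
  define C where "C = insert (space M - ?S) (range L)"
  have "emeasure ?M A \<noteq> \<infinity>" if "A \<in> C" for A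
    using that unfolding C_def
  proof
    assume "A = space M - ?S"
    then have "emeasure ?M A = 0"
      using S by (simp add: restrict_to_support_def emeasure_density indicator_inter_arith[symmetric])
    then show ?thesis by simp
  next
    assume "A \<in> range L"
    then obtain k n b where A: "A = {x\<in>space M. 1 / real (Suc n) \<le> ((if b then P k else Q k) x)\<^sup>2}"
      by (auto simp: L_def)
    have meas: "A \<in> sets M" unfolding A by (cases b) auto
    have "emeasure M A \<noteq> \<infinity>"
      unfolding A using L2 by (intro in_L2_level_set_finite) auto
    moreover have "emeasure ?M A \<le> emeasure M A"
      using S meas by (simp add: restrict_to_support_def emeasure_density
        indicator_inter_arith[symmetric] emeasure_mono)
    ultimately show ?thesis by (auto simp: top_unique)
  qed
  moreover have "\<Union>C = space ?M"
  proof
    show "\<Union>C \<subseteq> space ?M"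
      by (auto simp: C_def L_def restrict_to_support_def)
    have *: "\<exists>n. 1 / real (Suc n) \<le> y\<^sup>2" if "y \<noteq> 0" for y :: real
    proof -
      have "0 < y\<^sup>2" using that by simp
      then obtain n where "inverse (real (Suc n)) < y\<^sup>2"
        using reals_Archimedean by blast
      then show ?thesis
        by (intro exI[of _ n]) (simp add: inverse_eq_divide)
    qed
    show "space ?M \<subseteq> \<Union>C"
    proof
      fix x assume x: "x \<in> space ?M"
      show "x \<in> \<Union>C"
      proof (cases "x \<in> ?S")
        case False
        then show ?thesis using x by (auto simp: C_def restrict_to_support_def)
      next
        case True
        then obtain k where "P k x \<noteq> 0 \<or> Q k x \<noteq> 0"
          by (auto simp: joint_support_def)
        then have "(if P k x \<noteq> 0 then P k else Q k) x \<noteq> 0" by auto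
        then obtain b where "(if b then P k else Q k) x \<noteq> 0" by blast
        then obtain n where "x \<in> L (k, n, b)"
          using *[of "(if b then P k else Q k) x"] x by (auto simp: L_def restrict_to_support_def)
        then show ?thesis unfolding C_def by blast
      qed
    qed
  qed
  moreover have "C \<subseteq> sets ?M"
    using S unfolding C_def L_def by (auto simp: restrict_to_support_def)
  moreover have "countable C"
    unfolding C_def by auto
  ultimately show "\<exists>A. countable A \<and> A \<subseteq> sets ?M \<and> \<Union>A = space ?M \<and> (\<forall>a\<in>A. emeasure ?M a \<noteq> \<infinity>)"
    by blast
qed

lemma density_indicator_real:
  "density M (indicator S) = density M (\<lambda>x. ennreal (indicat_real S x))"
  by (rule arg_cong[where f="density M"]) (auto simp: fun_eq_iff split: split_indicator)

lemma in_L2_restrict: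
  assumes S: "S \<in> sets M" and f: "in_L2 M f"
  shows "in_L2 (density M (indicator S)) f"
proof -
  have [measurable]: "f \<in> borel_measurable M" and sq: "integrable M (\<lambda>x. (f x)\<^sup>2)"
    using f by (auto simp: in_L2_def)
  have "integrable M (\<lambda>x. indicator S x * (f x)\<^sup>2)"
    using integrable_mult_indicator[OF S sq] by simp
  then have "integrable (density M (indicator S)) (\<lambda>x. (f x)\<^sup>2)"
    unfolding density_indicator_real using S by (subst integrable_real_density) auto
  then show ?thesis
    by (simp add: in_L2_def)
qed

lemma L2_inner_restrict:
  assumes "S \<in> sets M" "(\<lambda>x. f x * g x) \<in> borel_measurable M" "\<And>x. x \<notin> S \<Longrightarrow> f x * g x = 0"
  shows "L2_inner (density M (indicator S)) f g = L2_inner M f g"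
proof -
  have "L2_inner (density M (indicator S)) f g = (\<integral>x. indicator S x * (f x * g x) \<partial>M)"
    unfolding L2_inner_def density_indicator_real using assms(1,2)
    by (subst integral_real_density) auto
  also have "\<dots> = L2_inner M f g"
    unfolding L2_inner_def using assms(3)
    by (intro Bochner_Integration.integral_cong) (auto split: split_indicator)
  finally show ?thesis .
qed

lemma biorthogonal_families_restrict:
  assumes "sets M = sets borel" "biorthogonal_families UNIV M P Q"
  shows "biorthogonal_families UNIV (restrict_to_support M P Q) P Q"
proof -
  have S: "joint_support P Q \<in> sets M"
    using joint_support_measurable[OF assms] .
  have "L2_inner (restrict_to_support M P Q) (P k) (Q m) = L2_inner M (P k) (Q m)" for k m
    unfolding restrict_to_support_def using assms(2) S
    by (intro L2_inner_restrict borel_measurable_times)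
      (auto simp: joint_support_def biorthogonal_families_def in_L2_def)
  moreover have "in_L2 (restrict_to_support M P Q) (P k)" "in_L2 (restrict_to_support M P Q) (Q k)" for k
    using assms(2) S in_L2_restrict unfolding restrict_to_support_def biorthogonal_families_def by auto
  ultimately show ?thesis
    using assms(2) unfolding biorthogonal_families_def by auto
qed

text \<open>
  A product measure is determined by its rectangles once its factors are $\sigma$-finite, so it is
  enough to compare rectangles.
\<close>
lemma PiM_restrict:
  assumes I: "finite I" and S: "S \<in> sets M"
    and sf: "sigma_finite_measure (density M (indicator S))"
    and nn: "emeasure (PiM I (\<lambda>_. M)) X \<noteq> 0"
  shows "density (PiM I (\<lambda>_. M)) (indicator (\<Pi>\<^sub>E i\<in>I. S)) = PiM I (\<lambda>_. density M (indicator S))"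
proof -
  interpret product_sigma_finite "\<lambda>_. density M (indicator S)"
    by (simp add: product_sigma_finite_def sf)
  have SI: "(\<Pi>\<^sub>E i\<in>I. S) \<in> sets (PiM I (\<lambda>_. M))"
    using I S by (intro sets_PiM_I_finite) auto
  show ?thesis
  proof (rule PiM_eqI[OF I])
    show "sets (density (PiM I (\<lambda>_. M)) (indicator (\<Pi>\<^sub>E i\<in>I. S)))
        = sets (PiM I (\<lambda>_. density M (indicator S)))"
      by (simp cong: sets_PiM_cong)
    fix A assume "\<And>i. i \<in> I \<Longrightarrow> A i \<in> sets (density M (indicator S))"
    then have A: "\<And>i. i \<in> I \<Longrightarrow> A i \<in> sets M" by simp
    then have AI: "Pi\<^sub>E I A \<in> sets (PiM I (\<lambda>_. M))"
      using I by (intro sets_PiM_I_finite) auto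
    have "emeasure (density (PiM I (\<lambda>_. M)) (indicator (\<Pi>\<^sub>E i\<in>I. S))) (Pi\<^sub>E I A)
        = emeasure (PiM I (\<lambda>_. M)) ((\<Pi>\<^sub>E i\<in>I. S) \<inter> Pi\<^sub>E I A)"
      using AI SI by (simp add: emeasure_density indicator_inter_arith[symmetric])
    also have "(\<Pi>\<^sub>E i\<in>I. S) \<inter> Pi\<^sub>E I A = (\<Pi>\<^sub>E i\<in>I. S \<inter> A i)"
      by auto
    also have "emeasure (PiM I (\<lambda>_. M)) \<dots> = (\<Prod>i\<in>I. emeasure M (S \<inter> A i))"
      using S A by (intro PiM_rectangle_if_not_null[OF I nn]) auto
    also have "\<dots> = (\<Prod>i\<in>I. emeasure (density M (indicator S)) (A i))"
      using S A by (intro prod.cong) (simp_all add: emeasure_density indicator_inter_arith[symmetric])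
    finally show "emeasure (density (PiM I (\<lambda>_. M)) (indicator (\<Pi>\<^sub>E i\<in>I. S))) (Pi\<^sub>E I A) = \<dots>" .
  qed
qed

text \<open>
  The law is a probability measure, so the underlying product measure is not null and its rectangles
  are the expected ones. This is where the hypothesis on the law rescues a product of possibly
  non-$\sigma$-finite measures.
\<close>
lemma ensemble_restrict_to_support:
  assumes ens: "biorthogonal_ensemble N M P Q" and bio: "biorthogonal_families UNIV M P Q"
  shows "ensemble_law N (restrict_to_support M P Q) P Q = ensemble_law N M P Q"
    and "AE x in PiM {..<N} (\<lambda>_. restrict_to_support M P Q). 0 \<le> ensemble_density N P Q x"
proof -
  let ?S = "joint_support P Q" and ?P = "PiM {..<N} (\<lambda>_. M)"
  let ?f = "\<lambda>x. ennreal (ensemble_density N P Q x)"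
  have M: "sets M = sets borel" and nonneg: "AE x in ?P. 0 \<le> ensemble_density N P Q x"
    and prob: "prob_space (density ?P ?f)"
    using ens by (auto simp: biorthogonal_ensemble_def ensemble_law_def)
  have S: "?S \<in> sets M" using joint_support_measurable[OF M bio] .
  have f: "?f \<in> borel_measurable ?P"
    using bio by (intro measurable_compose[OF ensemble_density_measurable measurable_ennreal])
      (auto simp: biorthogonal_families_def in_L2_def)
  have SI: "(\<Pi>\<^sub>E i\<in>{..<N}. ?S) \<in> sets ?P"
    using S by (intro sets_PiM_I_finite) auto
  have "emeasure ?P (space ?P) \<noteq> 0"
  proof
    assume "emeasure ?P (space ?P) = 0"
    then have "AE x in ?P. False"
      by (intro AE_I[where N="space ?P"]) auto
    then have "emeasure (density ?P ?f) (space ?P) = 0"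
      using f by (subst emeasure_density) (auto simp: nn_integral_0_iff_AE)
    moreover have "emeasure (density ?P ?f) (space ?P) = 1"
      using prob_space.emeasure_space_1[OF prob] by simp
    ultimately show False by simp
  qed
  then have eq: "PiM {..<N} (\<lambda>_. restrict_to_support M P Q) = density ?P (indicator (\<Pi>\<^sub>E i\<in>{..<N}. ?S))"
    unfolding restrict_to_support_def
    using sigma_finite_restrict_to_support[OF M bio] S
    by (intro PiM_restrict[symmetric]) (auto simp: restrict_to_support_def)
  have z: "ensemble_density N P Q x = 0" if x: "x \<in> space ?P" "x \<notin> (\<Pi>\<^sub>E i\<in>{..<N}. ?S)" for x
  proof -
    obtain i where "i < N" "x i \<notin> ?S"
      using x by (auto simp: space_PiM PiE_iff)
    then show ?thesis
      by (intro ensemble_density_outside[of i]) (auto simp: joint_support_def)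
  qed
  have "density (density ?P (indicator (\<Pi>\<^sub>E i\<in>{..<N}. ?S))) ?f
      = density ?P (\<lambda>x. indicator (\<Pi>\<^sub>E i\<in>{..<N}. ?S) x * ?f x)"
    using SI f by (intro density_density_eq) auto
  also have "\<dots> = density ?P ?f"
    using SI f z by (intro density_cong AE_I2) (auto split: split_indicator)
  finally show "ensemble_law N (restrict_to_support M P Q) P Q = ensemble_law N M P Q"
    unfolding ensemble_law_def eq .
  show "AE x in PiM {..<N} (\<lambda>_. restrict_to_support M P Q). 0 \<le> ensemble_density N P Q x"
    unfolding eq using nonneg SI by (subst AE_density) auto
qed

section \<open>Mean and variance of a linear statistic\<close>

lemma permutes_eq_off_two_points:
  assumes "\<sigma> permutes S" "\<tau> permutes S" "\<And>i. i \<in> S - {a, b} \<Longrightarrow> \<tau> i = \<sigma> i"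
  shows "\<tau> = \<sigma> \<or> \<tau> = \<sigma> \<circ> Transposition.transpose a b"
proof -
  have "Hilbert_Choice.inv \<sigma> \<circ> \<tau> permutes S"
    using assms by (intro permutes_compose permutes_inv)
  then have "Hilbert_Choice.inv \<sigma> \<circ> \<tau> permutes {a, b}"
    using assms by (rule_tac permutes_superset) (auto simp: permutes_inverses)
  then have "Hilbert_Choice.inv \<sigma> \<circ> \<tau> = id \<or> Hilbert_Choice.inv \<sigma> \<circ> \<tau> = Transposition.transpose a b"
    by (simp add: permutes_doubleton_iff)
  moreover have "\<sigma> \<circ> (Hilbert_Choice.inv \<sigma> \<circ> \<tau>) = \<tau>"
    using permutes_inv_o(1)[OF assms(1)] by (simp add: o_assoc)
  ultimately show ?thesis
    by (metis comp_id)
qed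

text \<open>
  In the integrated double sum over permutations, each particle that carries no test function
  contributes a Kronecker symbol and ties $\tau$ to $\sigma$. Two free particles leave two choices
  for $\tau$, which differ by a transposition and have opposite signs; the result is a
  $2\times 2$ determinant.
\<close>
lemma signed_sum_two_free_points:
  fixes B :: "nat \<Rightarrow> nat \<Rightarrow> real"
  assumes S: "finite S" "a \<in> S" "b \<in> S" "a \<noteq> b" and \<sigma>: "\<sigma> permutes S"
  shows "(\<Sum>\<tau> | \<tau> permutes S. of_int (sign \<sigma>) * of_int (sign \<tau>) *
           (\<Prod>i\<in>S. if i \<in> {a, b} then B (\<sigma> i) (\<tau> i) else if \<sigma> i = \<tau> i then 1 else 0))
         = B (\<sigma> a) (\<sigma> a) * B (\<sigma> b) (\<sigma> b) - B (\<sigma> a) (\<sigma> b) * B (\<sigma> b) (\<sigma> a)"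
    (is "(\<Sum>\<tau> | \<tau> permutes S. ?t \<tau>) = _")
proof -
  let ?\<sigma>' = "\<sigma> \<circ> Transposition.transpose a b"
  have tr: "Transposition.transpose a b permutes S"
    using S by (intro permutes_swap_id)
  then have \<sigma>': "?\<sigma>' permutes S" using \<sigma> by (rule permutes_compose)
  have ne: "\<sigma> \<noteq> ?\<sigma>'"
  proof
    assume "\<sigma> = ?\<sigma>'"
    then have "\<sigma> a = \<sigma> b" by (metis comp_apply transpose_apply_first)
    then show False using S permutes_inj[OF \<sigma>] by (auto dest: injD)
  qed
  have prod: "(\<Prod>i\<in>S. if i \<in> {a, b} then f i else if \<sigma> i = \<tau> i then 1 else 0) = f a * f b"
    if "\<And>i. i \<in> S - {a, b} \<Longrightarrow> \<sigma> i = \<tau> i" for f :: "nat \<Rightarrow> real" and \<tau>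
  proof -
    have "(\<Prod>i\<in>S. if i \<in> {a, b} then f i else if \<sigma> i = \<tau> i then 1 else 0)
        = (\<Prod>i\<in>{a, b}. if i \<in> {a, b} then f i else if \<sigma> i = \<tau> i then 1 else 0)"
      using S that by (intro prod.mono_neutral_right) auto
    also have "\<dots> = f a * f b" using S by simp
    finally show ?thesis .
  qed
  have "?t \<tau> = 0" if \<tau>: "\<tau> \<in> {\<tau>. \<tau> permutes S} - {\<sigma>, ?\<sigma>'}" for \<tau>
  proof -
    obtain i where "i \<in> S - {a, b}" "\<tau> i \<noteq> \<sigma> i"
      using permutes_eq_off_two_points[OF \<sigma>, of \<tau> a b] \<tau> by blast
    then show ?thesis using S(1) by (auto intro!: prod_zero bexI[of _ i])
  qed
  then have "(\<Sum>\<tau> | \<tau> permutes S. ?t \<tau>) = (\<Sum>\<tau>\<in>{\<sigma>, ?\<sigma>'}. ?t \<tau>)"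
    using S \<sigma> \<sigma>' by (intro sum.mono_neutral_right) (auto simp: finite_permutations)
  also have "\<dots> = ?t \<sigma> + ?t ?\<sigma>'"
    using ne by simp
  also have "?t \<sigma> = B (\<sigma> a) (\<sigma> a) * B (\<sigma> b) (\<sigma> b)"
    by (subst prod) (auto simp: sign_def)
  also have "?t ?\<sigma>' = - (B (\<sigma> a) (\<sigma> b) * B (\<sigma> b) (\<sigma> a))"
  proof -
    have "sign ?\<sigma>' = - sign \<sigma>"
      using S \<sigma> tr by (simp add: sign_compose permutes_imp_permutation sign_swap_id)
    then show ?thesis
      by (subst prod) (auto simp: sign_def transpose_def)
  qed
  finally show ?thesis by simp
qed

lemma signed_sum_one_free_point:
  fixes B :: "nat \<Rightarrow> nat \<Rightarrow> real"
  assumes S: "finite S" "a \<in> S" and \<sigma>: "\<sigma> permutes S"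
  shows "(\<Sum>\<tau> | \<tau> permutes S. of_int (sign \<sigma>) * of_int (sign \<tau>) *
           (\<Prod>i\<in>S. if i = a then B (\<sigma> i) (\<tau> i) else if \<sigma> i = \<tau> i then 1 else 0))
         = B (\<sigma> a) (\<sigma> a)"
    (is "(\<Sum>\<tau> | \<tau> permutes S. ?t \<tau>) = _")
proof -
  have "?t \<tau> = 0" if \<tau>: "\<tau> \<in> {\<tau>. \<tau> permutes S} - {\<sigma>}" for \<tau>
  proof -
    obtain i where "i \<in> S - {a}" "\<tau> i \<noteq> \<sigma> i"
      using permutes_eq_off_two_points[OF \<sigma>, of \<tau> a a] \<tau> by auto
    then show ?thesis using S(1) by (auto intro!: prod_zero bexI[of _ i])
  qed
  then have "(\<Sum>\<tau> | \<tau> permutes S. ?t \<tau>) = (\<Sum>\<tau>\<in>{\<sigma>}. ?t \<tau>)"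
    using S \<sigma> by (intro sum.mono_neutral_right) (auto simp: finite_permutations)
  also have "\<dots> = (\<Prod>i\<in>S. if i = a then B (\<sigma> i) (\<sigma> i) else 1)"
    by (auto simp: sign_def intro!: prod.cong)
  also have "\<dots> = B (\<sigma> a) (\<sigma> a)"
    using S by (simp add: prod.delta)
  finally show ?thesis .
qed

text \<open>
  The context in which Fubini's theorem applies to the ensemble law.
\<close>
locale sigma_finite_ensemble = sigma_finite_measure M for M :: "real measure" +
  fixes N :: nat and P Q :: "nat \<Rightarrow> real \<Rightarrow> real"
  assumes sets_M: "sets M = sets borel"
    and biorthogonal: "biorthogonal_families {..<N} M P Q"
    and density_nonneg: "AE x in PiM {..<N} (\<lambda>_. M). 0 \<le> ensemble_density N P Q x"
    and prob_law: "prob_space (ensemble_law N M P Q)"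
begin

sublocale product_sigma_finite "\<lambda>_. M"
  by standard

lemma measurable_PQ:
  "k < N \<Longrightarrow> P k \<in> borel_measurable M" "k < N \<Longrightarrow> Q k \<in> borel_measurable M"
  using biorthogonal by (auto simp: biorthogonal_families_def in_L2_def)

lemma borel_imp_measurable_M: "g \<in> borel_measurable borel \<Longrightarrow> g \<in> borel_measurable M"
  using measurable_cong_sets[OF sets_M refl] by blast

lemma measurable_particle:
  assumes "g \<in> borel_measurable borel" "a < N"
  shows "(\<lambda>x. g (x a)) \<in> borel_measurable (PiM {..<N} (\<lambda>_. M))"
  using assms borel_imp_measurable_M
  by (intro measurable_compose[OF measurable_component_singleton]) auto

text \<open>
  Andreief's identity, left in expanded form: Fubini turns each term of the density into a product
  of one-dimensional integrals.
\<close>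
lemma product_statistic:
  assumes h: "\<And>i. i < N \<Longrightarrow> h i \<in> borel_measurable borel"
    and int: "\<And>i k m. i < N \<Longrightarrow> k < N \<Longrightarrow> m < N \<Longrightarrow> integrable M (\<lambda>t. h i t * (P k t * Q m t))"
  shows "integrable (ensemble_law N M P Q) (\<lambda>x. \<Prod>i<N. h i (x i))"
    and "(\<integral>x. (\<Prod>i<N. h i (x i)) \<partial>ensemble_law N M P Q) =
      1 / fact N * (\<Sum>\<sigma> | \<sigma> permutes {..<N}. \<Sum>\<tau> | \<tau> permutes {..<N}.
        of_int (sign \<sigma>) * of_int (sign \<tau>) * (\<Prod>i<N. \<integral>t. h i t * (P (\<sigma> i) t * Q (\<tau> i) t) \<partial>M))"
proof -
  let ?P = "PiM {..<N} (\<lambda>_. M)"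
  let ?D = "ensemble_density N P Q"
  let ?c = "\<lambda>\<sigma> \<tau>. 1 / fact N * of_int (sign \<sigma>) * of_int (sign \<tau>) :: real"
  let ?F = "\<lambda>\<sigma> \<tau> x. \<Prod>i<N. h i (x i) * (P (\<sigma> i) (x i) * Q (\<tau> i) (x i))"
  have expand: "?D x * (\<Prod>i<N. h i (x i)) =
      (\<Sum>\<sigma> | \<sigma> permutes {..<N}. \<Sum>\<tau> | \<tau> permutes {..<N}. ?c \<sigma> \<tau> * ?F \<sigma> \<tau> x)" for x
    unfolding ensemble_density_permutes
    by (simp add: prod.distrib sum_distrib_left sum_distrib_right mult_ac)
  have hM: "(\<lambda>x. \<Prod>i<N. h i (x i)) \<in> borel_measurable ?P"
    using h measurable_particle by (intro borel_measurable_prod) auto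
  have D: "?D \<in> borel_measurable ?P"
    using measurable_PQ by (rule ensemble_density_measurable)
  have I: "integrable M (\<lambda>t. h i t * (P (\<sigma> i) t * Q (\<tau> i) t))"
    if "\<sigma> permutes {..<N}" "\<tau> permutes {..<N}" "i \<in> {..<N}" for \<sigma> \<tau> i
    using that permutes_in_image[OF that(1), of i] permutes_in_image[OF that(2), of i]
    by (intro int) auto
  have IF: "integrable ?P (?F \<sigma> \<tau>)"
    if "\<sigma> permutes {..<N}" "\<tau> permutes {..<N}" for \<sigma> \<tau>
    using I[OF that] by (intro product_integrable_prod) auto
  have "integrable ?P (\<lambda>x. ?D x * (\<Prod>i<N. h i (x i)))"
    unfolding expand using IF
    by (intro Bochner_Integration.integrable_sum integrable_mult_right) auto
  then show "integrable (ensemble_law N M P Q) (\<lambda>x. \<Prod>i<N. h i (x i))"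
    unfolding ensemble_law_def
    using integrable_real_density[OF D density_nonneg hM] by simp
  have "(\<integral>x. (\<Prod>i<N. h i (x i)) \<partial>ensemble_law N M P Q) = (\<integral>x. ?D x * (\<Prod>i<N. h i (x i)) \<partial>?P)"
    unfolding ensemble_law_def by (rule integral_real_density[OF D density_nonneg hM])
  also have "\<dots> = (\<Sum>\<sigma> | \<sigma> permutes {..<N}. \<Sum>\<tau> | \<tau> permutes {..<N}. ?c \<sigma> \<tau> * (\<integral>x. ?F \<sigma> \<tau> x \<partial>?P))"
    unfolding expand using IF
    by (subst Bochner_Integration.integral_sum; 
        (intro Bochner_Integration.integrable_sum integrable_mult_right sum.cong refl)?)
      (auto simp: Bochner_Integration.integral_sum)
  also have "\<dots> = (\<Sum>\<sigma> | \<sigma> permutes {..<N}. \<Sum>\<tau> | \<tau> permutes {..<N}.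
      ?c \<sigma> \<tau> * (\<Prod>i<N. \<integral>t. h i t * (P (\<sigma> i) t * Q (\<tau> i) t) \<partial>M))"
    using I by (intro sum.cong refl arg_cong2[where f="(*)"] product_integral_prod) auto
  finally show "(\<integral>x. (\<Prod>i<N. h i (x i)) \<partial>ensemble_law N M P Q) =
      1 / fact N * (\<Sum>\<sigma> | \<sigma> permutes {..<N}. \<Sum>\<tau> | \<tau> permutes {..<N}.
        of_int (sign \<sigma>) * of_int (sign \<tau>) * (\<Prod>i<N. \<integral>t. h i t * (P (\<sigma> i) t * Q (\<tau> i) t) \<partial>M))"
    by (simp add: sum_distrib_left mult_ac)
qed

lemma integrable_PQ:
  "k < N \<Longrightarrow> m < N \<Longrightarrow> integrable M (\<lambda>t. P k t * Q m t)"
  using biorthogonal by (intro in_L2_integrable_mult) (auto simp: biorthogonal_families_def)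

lemma integral_PQ:
  "k < N \<Longrightarrow> m < N \<Longrightarrow> (\<integral>t. P k t * Q m t \<partial>M) = (if k = m then 1 else 0)"
  using biorthogonal by (auto simp: biorthogonal_families_def L2_inner_def)

lemma one_particle:
  assumes g: "g \<in> borel_measurable borel"
    and int: "\<And>k m. k < N \<Longrightarrow> m < N \<Longrightarrow> integrable M (\<lambda>t. g t * (P k t * Q m t))"
    and a: "a < N"
  defines "B \<equiv> \<lambda>k m. \<integral>t. g t * (P k t * Q m t) \<partial>M"
  shows "integrable (ensemble_law N M P Q) (\<lambda>x. g (x a))"
    and "(\<integral>x. g (x a) \<partial>ensemble_law N M P Q)
         = 1 / fact N * (\<Sum>\<sigma> | \<sigma> permutes {..<N}. B (\<sigma> a) (\<sigma> a))"
proof -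
  let ?h = "\<lambda>i t. if i = a then g t else 1"
  have prod: "(\<Prod>i<N. ?h i (x i)) = g (x a)" for x
    using a by (simp add: prod.delta)
  have h: "?h i \<in> borel_measurable borel" for i
    using g by auto
  have I: "integrable M (\<lambda>t. ?h i t * (P k t * Q m t))" if "k < N" "m < N" for i k m
    using int[OF that] integrable_PQ[OF that] by (cases "i = a") auto
  show "integrable (ensemble_law N M P Q) (\<lambda>x. g (x a))"
    using product_statistic(1)[of ?h] h I unfolding prod by blast
  have "(\<integral>x. g (x a) \<partial>ensemble_law N M P Q) =
      1 / fact N * (\<Sum>\<sigma> | \<sigma> permutes {..<N}. \<Sum>\<tau> | \<tau> permutes {..<N}.
        of_int (sign \<sigma>) * of_int (sign \<tau>) * (\<Prod>i<N. \<integral>t. ?h i t * (P (\<sigma> i) t * Q (\<tau> i) t) \<partial>M))"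
    using product_statistic(2)[of ?h] h I unfolding prod by blast
  also have "\<dots> = 1 / fact N * (\<Sum>\<sigma> | \<sigma> permutes {..<N}. \<Sum>\<tau> | \<tau> permutes {..<N}.
        of_int (sign \<sigma>) * of_int (sign \<tau>) *
          (\<Prod>i<N. if i = a then B (\<sigma> i) (\<tau> i) else if \<sigma> i = \<tau> i then 1 else 0))"
  proof (intro arg_cong2[where f="(*)"] sum.cong prod.cong refl)
    fix \<sigma> \<tau> i
    assume "\<sigma> \<in> {\<sigma>. \<sigma> permutes {..<N}}" "\<tau> \<in> {\<sigma>. \<sigma> permutes {..<N}}" "i \<in> {..<N}"
    then have "\<sigma> i < N" "\<tau> i < N"
      using permutes_in_image[of \<sigma> "{..<N}" i] permutes_in_image[of \<tau> "{..<N}" i] by auto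
    then show "(\<integral>t. ?h i t * (P (\<sigma> i) t * Q (\<tau> i) t) \<partial>M)
        = (if i = a then B (\<sigma> i) (\<tau> i) else if \<sigma> i = \<tau> i then 1 else 0)"
      using integral_PQ[of "\<sigma> i" "\<tau> i"] by (auto simp: B_def)
  qed
  also have "\<dots> = 1 / fact N * (\<Sum>\<sigma> | \<sigma> permutes {..<N}. B (\<sigma> a) (\<sigma> a))"
    using a by (intro arg_cong2[where f="(*)"] sum.cong refl signed_sum_one_free_point) auto
  finally show "(\<integral>x. g (x a) \<partial>ensemble_law N M P Q)
         = 1 / fact N * (\<Sum>\<sigma> | \<sigma> permutes {..<N}. B (\<sigma> a) (\<sigma> a))" .
qed

lemma two_particles:
  assumes g: "g \<in> borel_measurable borel"
    and int: "\<And>k m. k < N \<Longrightarrow> m < N \<Longrightarrow> integrable M (\<lambda>t. g t * (P k t * Q m t))"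
    and ab: "a < N" "b < N" "a \<noteq> b"
  defines "B \<equiv> \<lambda>k m. \<integral>t. g t * (P k t * Q m t) \<partial>M"
  shows "integrable (ensemble_law N M P Q) (\<lambda>x. g (x a) * g (x b))"
    and "(\<integral>x. g (x a) * g (x b) \<partial>ensemble_law N M P Q)
         = 1 / fact N * (\<Sum>\<sigma> | \<sigma> permutes {..<N}.
             B (\<sigma> a) (\<sigma> a) * B (\<sigma> b) (\<sigma> b) - B (\<sigma> a) (\<sigma> b) * B (\<sigma> b) (\<sigma> a))"
proof -
  let ?h = "\<lambda>i t. if i \<in> {a, b} then g t else 1"
  have prod: "(\<Prod>i<N. ?h i (x i)) = g (x a) * g (x b)" for x
  proof -
    have "(\<Prod>i<N. ?h i (x i)) = (\<Prod>i\<in>{a, b}. ?h i (x i))"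
      using ab by (intro prod.mono_neutral_right) auto
    then show ?thesis using ab by simp
  qed
  have h: "?h i \<in> borel_measurable borel" for i
    using g by auto
  have I: "integrable M (\<lambda>t. ?h i t * (P k t * Q m t))" if "k < N" "m < N" for i k m
    using int[OF that] integrable_PQ[OF that] by (cases "i \<in> {a, b}") auto
  show "integrable (ensemble_law N M P Q) (\<lambda>x. g (x a) * g (x b))"
    using product_statistic(1)[of ?h] h I unfolding prod by blast
  have "(\<integral>x. g (x a) * g (x b) \<partial>ensemble_law N M P Q) =
      1 / fact N * (\<Sum>\<sigma> | \<sigma> permutes {..<N}. \<Sum>\<tau> | \<tau> permutes {..<N}.
        of_int (sign \<sigma>) * of_int (sign \<tau>) * (\<Prod>i<N. \<integral>t. ?h i t * (P (\<sigma> i) t * Q (\<tau> i) t) \<partial>M))"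
    using product_statistic(2)[of ?h] h I unfolding prod by blast
  also have "\<dots> = 1 / fact N * (\<Sum>\<sigma> | \<sigma> permutes {..<N}. \<Sum>\<tau> | \<tau> permutes {..<N}.
        of_int (sign \<sigma>) * of_int (sign \<tau>) *
          (\<Prod>i<N. if i \<in> {a, b} then B (\<sigma> i) (\<tau> i) else if \<sigma> i = \<tau> i then 1 else 0))"
  proof (intro arg_cong2[where f="(*)"] sum.cong prod.cong refl)
    fix \<sigma> \<tau> i
    assume "\<sigma> \<in> {\<sigma>. \<sigma> permutes {..<N}}" "\<tau> \<in> {\<sigma>. \<sigma> permutes {..<N}}" "i \<in> {..<N}"
    then have "\<sigma> i < N" "\<tau> i < N"
      using permutes_in_image[of \<sigma> "{..<N}" i] permutes_in_image[of \<tau> "{..<N}" i] by auto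
    then show "(\<integral>t. ?h i t * (P (\<sigma> i) t * Q (\<tau> i) t) \<partial>M)
        = (if i \<in> {a, b} then B (\<sigma> i) (\<tau> i) else if \<sigma> i = \<tau> i then 1 else 0)"
      using integral_PQ[of "\<sigma> i" "\<tau> i"] by (auto simp: B_def)
  qed
  also have "\<dots> = 1 / fact N * (\<Sum>\<sigma> | \<sigma> permutes {..<N}.
      B (\<sigma> a) (\<sigma> a) * B (\<sigma> b) (\<sigma> b) - B (\<sigma> a) (\<sigma> b) * B (\<sigma> b) (\<sigma> a))"
    using ab by (intro arg_cong2[where f="(*)"] sum.cong refl signed_sum_two_free_points) auto
  finally show "(\<integral>x. g (x a) * g (x b) \<partial>ensemble_law N M P Q)
         = 1 / fact N * (\<Sum>\<sigma> | \<sigma> permutes {..<N}.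
             B (\<sigma> a) (\<sigma> a) * B (\<sigma> b) (\<sigma> b) - B (\<sigma> a) (\<sigma> b) * B (\<sigma> b) (\<sigma> a))" .
qed

text \<open>
  Summing over all particles replaces the labels $\sigma(a), \sigma(b)$ by free indices, the same
  for each $\sigma$, and the $N!$ permutations cancel the normalisation.
\<close>
lemma average_over_permutations:
  fixes G :: "nat \<Rightarrow> nat \<Rightarrow> real"
  shows "(\<Sum>a<N. \<Sum>b<N. 1 / fact N * (\<Sum>\<sigma> | \<sigma> permutes {..<N}. G (\<sigma> a) (\<sigma> b)))
       = (\<Sum>k<N. \<Sum>m<N. G k m)"
proof -
  have "(\<Sum>a<N. \<Sum>b<N. \<Sum>\<sigma> | \<sigma> permutes {..<N}. G (\<sigma> a) (\<sigma> b))
      = (\<Sum>\<sigma> | \<sigma> permutes {..<N}. \<Sum>a<N. \<Sum>b<N. G (\<sigma> a) (\<sigma> b))"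
    by (simp only: sum.swap[of _ "{\<sigma>. \<sigma> permutes {..<N}}"])
  also have "\<dots> = (\<Sum>\<sigma> | \<sigma> permutes {..<N}. \<Sum>k<N. \<Sum>m<N. G k m)"
  proof (rule sum.cong[OF refl])
    fix \<sigma> assume "\<sigma> \<in> {\<sigma>. \<sigma> permutes {..<N}}"
    then have \<sigma>: "\<sigma> permutes {..<N}" by simp
    have "(\<Sum>a<N. \<Sum>b<N. G (\<sigma> a) (\<sigma> b)) = (\<Sum>a<N. \<Sum>m<N. G (\<sigma> a) m)"
      using sum.permute[OF \<sigma>, of "G (\<sigma> a)" for a] by (simp add: comp_def)
    also have "\<dots> = (\<Sum>k<N. \<Sum>m<N. G k m)"
      using sum.permute[OF \<sigma>, of "\<lambda>k. \<Sum>m<N. G k m"] by (simp add: comp_def)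
    finally show "(\<Sum>a<N. \<Sum>b<N. G (\<sigma> a) (\<sigma> b)) = (\<Sum>k<N. \<Sum>m<N. G k m)" .
  qed
  also have "\<dots> = fact N * (\<Sum>k<N. \<Sum>m<N. G k m)"
    by (simp add: card_permutations)
  finally show ?thesis
    by (simp add: sum_divide_distrib[symmetric])
qed

text \<open>
  With $B_{km} = \langle g P_k, Q_m\rangle$ the mean is $\mathrm{tr}\,B$, and the pairs of distinct
  particles contribute $(\mathrm{tr}\,B)^2 - \mathrm{tr}(B^2)$ to the second moment. The square of
  the mean cancels, leaving the diagonal pairs minus $\mathrm{tr}(B^2)$.
\<close>
lemma linear_statistic_variance:
  assumes g: "g \<in> borel_measurable borel"
    and int: "\<And>k m. k < N \<Longrightarrow> m < N \<Longrightarrow> integrable M (\<lambda>t. g t * (P k t * Q m t))"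
    and int2: "\<And>k m. k < N \<Longrightarrow> m < N \<Longrightarrow> integrable M (\<lambda>t. (g t)\<^sup>2 * (P k t * Q m t))"
  defines "B \<equiv> \<lambda>k m. \<integral>t. g t * (P k t * Q m t) \<partial>M"
  shows "in_L2 (ensemble_law N M P Q) (\<lambda>x. \<Sum>a<N. g (x a))"
    and "prob_space.variance (ensemble_law N M P Q) (\<lambda>x. \<Sum>a<N. g (x a))
      = (\<Sum>k<N. \<integral>t. (g t)\<^sup>2 * (P k t * Q k t) \<partial>M) - (\<Sum>k<N. \<Sum>m<N. B k m * B m k)"
proof -
  let ?L = "ensemble_law N M P Q"
  let ?X = "\<lambda>x. \<Sum>a<N. g (x a)"
  interpret L: prob_space ?L by (rule prob_law)
  define B2 where "B2 = (\<lambda>k m. \<integral>t. (g t)\<^sup>2 * (P k t * Q m t) \<partial>M)"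
  \<comment> \<open>The determinant vanishes on the diagonal, so one formula covers coinciding and distinct
    particles.\<close>
  define G where "G = (\<lambda>k m. (if k = m then B2 k k else 0) + B k k * B m m - B k m * B m k)"
  have g2: "(\<lambda>t. (g t)\<^sup>2) \<in> borel_measurable borel" using g by measurable
  note one = one_particle[OF g int] and sq = one_particle[OF g2 int2] and two = two_particles[OF g int]
  have pair: "integrable ?L (\<lambda>x. g (x a) * g (x b))"
    "(\<integral>x. g (x a) * g (x b) \<partial>?L) = 1 / fact N * (\<Sum>\<sigma> | \<sigma> permutes {..<N}. G (\<sigma> a) (\<sigma> b))"
    if "a < N" "b < N" for a b
  proof -
    have "integrable ?L (\<lambda>x. g (x a) * g (x b)) \<and>
      (\<integral>x. g (x a) * g (x b) \<partial>?L) = 1 / fact N * (\<Sum>\<sigma> | \<sigma> permutes {..<N}. G (\<sigma> a) (\<sigma> b))"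
    proof (cases "a = b")
      case True
      then show ?thesis
        using sq[OF _ _ that(1)] by (simp add: G_def B2_def power2_eq_square)
    next
      case False
      have "G (\<sigma> a) (\<sigma> b) = B (\<sigma> a) (\<sigma> a) * B (\<sigma> b) (\<sigma> b) - B (\<sigma> a) (\<sigma> b) * B (\<sigma> b) (\<sigma> a)"
        if "\<sigma> permutes {..<N}" for \<sigma>
        using False permutes_inj[OF that] by (auto simp: G_def dest: injD)
      then have "(\<Sum>\<sigma> | \<sigma> permutes {..<N}. G (\<sigma> a) (\<sigma> b)) = (\<Sum>\<sigma> | \<sigma> permutes {..<N}.
          B (\<sigma> a) (\<sigma> a) * B (\<sigma> b) (\<sigma> b) - B (\<sigma> a) (\<sigma> b) * B (\<sigma> b) (\<sigma> a))"
        by (intro sum.cong) auto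
      then show ?thesis
        using two[OF _ _ that False] by (simp only: B_def)
    qed
    then show "integrable ?L (\<lambda>x. g (x a) * g (x b))"
      "(\<integral>x. g (x a) * g (x b) \<partial>?L) = 1 / fact N * (\<Sum>\<sigma> | \<sigma> permutes {..<N}. G (\<sigma> a) (\<sigma> b))"
      by auto
  qed
  have square: "(?X x)\<^sup>2 = (\<Sum>a<N. \<Sum>b<N. g (x a) * g (x b))" for x
    by (simp add: power2_eq_square sum_product)
  have intX: "integrable ?L ?X"
    using one(1) by (intro Bochner_Integration.integrable_sum) auto
  have intX2: "integrable ?L (\<lambda>x. (?X x)\<^sup>2)"
    unfolding square using pair(1) by (intro Bochner_Integration.integrable_sum) auto
  show "in_L2 ?L ?X"
    using intX intX2 by (auto simp: in_L2_def)
  have E2: "L.expectation (\<lambda>x. (?X x)\<^sup>2) = (\<Sum>k<N. \<Sum>m<N. G k m)"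
  proof -
    have "L.expectation (\<lambda>x. (?X x)\<^sup>2) = (\<Sum>a<N. \<integral>x. (\<Sum>b<N. g (x a) * g (x b)) \<partial>?L)"
      unfolding square
      by (intro Bochner_Integration.integral_sum Bochner_Integration.integrable_sum pair(1)) auto
    also have "\<dots> = (\<Sum>a<N. \<Sum>b<N. \<integral>x. g (x a) * g (x b) \<partial>?L)"
      by (intro sum.cong refl Bochner_Integration.integral_sum pair(1)) auto
    also have "\<dots> = (\<Sum>a<N. \<Sum>b<N. 1 / fact N * (\<Sum>\<sigma> | \<sigma> permutes {..<N}. G (\<sigma> a) (\<sigma> b)))"
      using pair(2) by (intro sum.cong refl) auto
    finally show ?thesis
      by (simp only: average_over_permutations)
  qed
  have E1: "L.expectation ?X = (\<Sum>k<N. B k k)"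
  proof (cases "N = 0")
    case False
    have "L.expectation ?X = (\<Sum>a<N. 1 / fact N * (\<Sum>\<sigma> | \<sigma> permutes {..<N}. B (\<sigma> a) (\<sigma> a)))"
      using one by (simp add: Bochner_Integration.integral_sum B_def)
    also have "real N * \<dots> = (\<Sum>a<N. \<Sum>b<N. 1 / fact N * (\<Sum>\<sigma> | \<sigma> permutes {..<N}. B (\<sigma> a) (\<sigma> a)))"
      by (simp add: sum_distrib_left)
    also have "\<dots> = real N * (\<Sum>k<N. B k k)"
      using average_over_permutations[of "\<lambda>k m. B k k"] by (simp add: sum_distrib_left)
    finally show ?thesis using False by simp
  qed simp
  have "L.variance ?X = L.expectation (\<lambda>x. (?X x)\<^sup>2) - (L.expectation ?X)\<^sup>2"
    by (rule L.variance_eq[OF intX intX2])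
  also have "\<dots> = (\<Sum>k<N. B2 k k) - (\<Sum>k<N. \<Sum>m<N. B k m * B m k)"
    unfolding E1 E2 G_def
    by (simp add: sum.distrib sum_subtractf power2_eq_square sum_product sum.delta)
  finally show "L.variance ?X = (\<Sum>k<N. \<integral>t. (g t)\<^sup>2 * (P k t * Q k t) \<partial>M) - (\<Sum>k<N. \<Sum>m<N. B k m * B m k)"
    by (simp add: B2_def)
qed

end

section \<open>Powers of the multiplication operator\<close>

locale banded_biorthogonal =
  fixes M :: "real measure" and P Q :: "nat \<Rightarrow> real \<Rightarrow> real" and q :: nat
  assumes sets_M: "sets M = sets borel"
    and families: "biorthogonal_families UNIV M P Q"
    and recurrence: "\<And>k. \<exists>c. AE x in M. x * P k x = (\<Sum>m\<le>k + q. c m * P m x)"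
begin

text \<open>
  For \<open>l = 1\<close> this is the matrix of multiplication by \<open>x\<close> in the given families, and for general
  \<open>l\<close> it is the \<open>l\<close>-th power of that matrix (by \<open>moment_add\<close> below; the sums are finite because the
  matrix has only \<open>q\<close> diagonals above the main one).
\<close>
definition moment :: "nat \<Rightarrow> nat \<Rightarrow> nat \<Rightarrow> real" where
  "moment l k m = L2_inner M (\<lambda>x. x ^ l * P k x) (Q m)"

lemma L2_P: "in_L2 M (P k)" and L2_Q: "in_L2 M (Q k)"
  using families unfolding biorthogonal_families_def by blast+

lemma inner_PQ: "L2_inner M (P k) (Q m) = (if k = m then 1 else 0)"
  using families unfolding biorthogonal_families_def by blast

lemma measurable_power_P: "(\<lambda>x. x ^ l * P k x) \<in> borel_measurable M"
proof -
  have "(\<lambda>x. x ^ l) \<in> borel_measurable M"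
    by (intro borel_measurable_power measurable_ident_sets sets_M)
  moreover have "P k \<in> borel_measurable M"
    using L2_P by (simp add: in_L2_def)
  ultimately show ?thesis
    by (rule borel_measurable_times)
qed

text \<open>
  Each multiplication by \<open>x\<close> raises the index by at most \<open>q\<close>.
\<close>
lemma power_in_span: "\<exists>c. AE x in M. x ^ l * P k x = (\<Sum>m\<le>k + l * q. c m * P m x)"
proof (induction l)
  case 0
  have "x ^ 0 * P k x = (\<Sum>m\<le>k + 0 * q. (if m = k then 1 else 0) * P m x)" for x
    by (simp add: if_distrib[of "\<lambda>c. c * _"] sum.delta cong: if_cong)
  then show ?case by (intro exI[of _ "\<lambda>m. if m = k then 1 else 0"] AE_I2)
next
  case (Suc l)
  then obtain d where d: "AE x in M. x ^ l * P k x = (\<Sum>j\<le>k + l * q. d j * P j x)" by blast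
  obtain C where C: "\<And>j. AE x in M. x * P j x = (\<Sum>m\<le>j + q. C j m * P m x)"
    using recurrence by metis
  let ?C = "\<lambda>j m. if m \<le> j + q then C j m else 0"
  let ?c = "\<lambda>m. \<Sum>j\<le>k + l * q. d j * ?C j m"
  have "AE x in M. \<forall>j. x * P j x = (\<Sum>m\<le>j + q. C j m * P m x)"
    using C by (simp add: AE_all_countable)
  with d have "AE x in M. x ^ Suc l * P k x = (\<Sum>m\<le>k + Suc l * q. ?c m * P m x)"
  proof eventually_elim
    case (elim x)
    have j: "x * P j x = (\<Sum>m\<le>k + Suc l * q. ?C j m * P m x)" if "j \<le> k + l * q" for j
    proof -
      have "x * P j x = (\<Sum>m\<le>j + q. ?C j m * P m x)"
        unfolding elim(2)[rule_format, of j] by (intro sum.cong) auto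
      also have "\<dots> = (\<Sum>m\<le>k + Suc l * q. ?C j m * P m x)"
        using that by (intro sum.mono_neutral_left) auto
      finally show ?thesis .
    qed
    have "x ^ Suc l * P k x = x * (x ^ l * P k x)" by simp
    also have "\<dots> = (\<Sum>j\<le>k + l * q. d j * (x * P j x))"
      unfolding elim(1) by (simp add: sum_distrib_left mult_ac)
    also have "\<dots> = (\<Sum>j\<le>k + l * q. \<Sum>m\<le>k + Suc l * q. d j * (?C j m * P m x))"
      using j by (simp add: sum_distrib_left)
    also have "\<dots> = (\<Sum>m\<le>k + Suc l * q. \<Sum>j\<le>k + l * q. d j * (?C j m * P m x))"
      by (rule sum.swap)
    finally show ?case by (simp only: sum_distrib_right mult.assoc)
  qed
  then show ?case by (intro exI)
qed

text \<open>
  Pairing with \<open>Q m\<close> reads off the coefficient of \<open>P m\<close>.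
\<close>
lemma span_coefficients:
  assumes f: "f \<in> borel_measurable M" "AE x in M. f x = (\<Sum>j\<le>n. c j * P j x)"
  shows "in_L2 M f" and "L2_inner M f (Q m) = (if m \<le> n then c m else 0)"
proof -
  have "in_L2 M (\<lambda>x. \<Sum>j\<le>n. c j * P j x)"
    by (intro in_L2_sum in_L2_scale L2_P)
  then show "in_L2 M f"
    using f by (rule in_L2_cong_AE)
  have I: "integrable M (\<lambda>x. c j * (P j x * Q m x))" for j
    by (intro integrable_mult_right in_L2_integrable_mult L2_P L2_Q)
  have [measurable]: "P j \<in> borel_measurable M" "Q j \<in> borel_measurable M" for j
    using L2_P L2_Q by (auto simp: in_L2_def)
  have "L2_inner M f (Q m) = (\<integral>x. (\<Sum>j\<le>n. c j * (P j x * Q m x)) \<partial>M)"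
    unfolding L2_inner_def using f
    by (intro integral_cong_AE) (auto simp: sum_distrib_right sum_distrib_left mult_ac)
  also have "\<dots> = (\<Sum>j\<le>n. c j * L2_inner M (P j) (Q m))"
    using I by (simp add: L2_inner_def)
  also have "\<dots> = (if m \<le> n then c m else 0)"
    by (simp add: inner_PQ if_distrib[of "\<lambda>d. _ * d"] sum.delta cong: if_cong)
  finally show "L2_inner M f (Q m) = (if m \<le> n then c m else 0)" .
qed

lemma L2_power_P: "in_L2 M (\<lambda>x. x ^ l * P k x)"
  using span_coefficients(1)[OF measurable_power_P] power_in_span by blast

lemma moment_eq_0:
  assumes "k + l * q < m"
  shows "moment l k m = 0"
proof -
  obtain c where c: "AE x in M. x ^ l * P k x = (\<Sum>m\<le>k + l * q. c m * P m x)"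
    using power_in_span by blast
  show ?thesis
    using span_coefficients(2)[OF measurable_power_P c, of m] assms by (simp add: moment_def)
qed

lemma power_expansion: "AE x in M. x ^ l * P k x = (\<Sum>j\<le>k + l * q. moment l k j * P j x)"
proof -
  obtain c where c: "AE x in M. x ^ l * P k x = (\<Sum>m\<le>k + l * q. c m * P m x)"
    using power_in_span by blast
  have "moment l k j = c j" if "j \<le> k + l * q" for j
    using span_coefficients(2)[OF measurable_power_P c, of j] that by (simp add: moment_def)
  then have "(\<Sum>j\<le>k + l * q. moment l k j * P j x) = (\<Sum>m\<le>k + l * q. c m * P m x)" for x
    by simp
  with c show ?thesis by simp
qed

lemma moment_0: "moment 0 k m = (if k = m then 1 else 0)"
  by (simp add: moment_def inner_PQ)

lemma integrable_power_PQ: "integrable M (\<lambda>x. x ^ l * (P k x * Q m x))"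
  using in_L2_integrable_mult[OF L2_power_P[of l k] L2_Q[of m]] by (simp add: mult_ac)

lemma moment_integral: "moment l k m = (\<integral>x. x ^ l * (P k x * Q m x) \<partial>M)"
  by (simp add: moment_def L2_inner_def mult_ac)

text \<open>
  Expand \<open>x ^ l * P k\<close> in the family \<open>P\<close>, multiply by \<open>x ^ l'\<close> and pair with \<open>Q m\<close>.
\<close>
lemma moment_add: "moment (l + l') k m = (\<Sum>j\<le>k + l * q. moment l k j * moment l' j m)"
proof -
  have [measurable]: "(\<lambda>x. x ^ l * (P k x * Q m x)) \<in> borel_measurable M" for l k m
    using integrable_power_PQ by (rule borel_measurable_integrable)
  have "moment (l + l') k m = (\<integral>x. (\<Sum>j\<le>k + l * q. moment l k j * (x ^ l' * (P j x * Q m x))) \<partial>M)"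
    unfolding moment_integral[of "l + l'"]
  proof (intro integral_cong_AE)
    show "AE x in M. x ^ (l + l') * (P k x * Q m x)
        = (\<Sum>j\<le>k + l * q. moment l k j * (x ^ l' * (P j x * Q m x)))"
      using power_expansion[of l k]
    proof eventually_elim
      case (elim x)
      have "x ^ (l + l') * (P k x * Q m x) = (x ^ l * P k x) * (x ^ l' * Q m x)"
        by (simp add: power_add mult_ac)
      then show ?case
        unfolding elim sum_distrib_right by (simp add: mult_ac)
    qed
  qed auto
  also have "\<dots> = (\<Sum>j\<le>k + l * q. moment l k j * moment l' j m)"
    using integrable_power_PQ by (simp add: moment_integral)
  finally show ?thesis .
qed

text \<open>
  An entry of the \<open>l\<close>-th power is a sum over paths of \<open>l\<close> steps from \<open>k\<close> to \<open>m\<close>. A step may go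
  down by any amount but up by at most \<open>q\<close>. A path that has to end at \<open>m\<close> can therefore never fall
  below \<open>m - l * q\<close>, and it never rises above \<open>k + l * q\<close>. All its vertices stay in \<open>{L..U}\<close>, where
  the one-step entries are bounded by \<open>W\<close>.
\<close>
lemma moment_bound:
  assumes W: "\<And>a b. L \<le> a \<Longrightarrow> a \<le> U \<Longrightarrow> L \<le> b \<Longrightarrow> b \<le> U \<Longrightarrow> \<bar>moment 1 a b\<bar> \<le> W"
    and W0: "0 \<le> W" and m: "L + l * q \<le> m" and k: "k + l * q \<le> U"
  shows "\<bar>moment l k m\<bar> \<le> (real (U + 1 - L) * W) ^ l"
  using m k
proof (induction l arbitrary: k)
  case 0
  then show ?case by (simp add: moment_0)
next
  case (Suc l)
  let ?R = "real (U + 1 - L) * W"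
  have R0: "0 \<le> ?R" using W0 by simp
  show ?case
  proof (cases "k + Suc l * q < m")
    case True
    then show ?thesis using R0 by (simp add: moment_eq_0 del: mult_Suc)
  next
    case False
    then have k: "L \<le> k" using Suc.prems by simp
    have "moment (Suc l) k m = (\<Sum>j\<le>k + q. moment 1 k j * moment l j m)"
      using moment_add[of 1 l k m] by simp
    also have "\<dots> = (\<Sum>j\<in>{L..k + q}. moment 1 k j * moment l j m)"
      using Suc.prems(1) by (intro sum.mono_neutral_right) (auto simp: moment_eq_0)
    finally have "\<bar>moment (Suc l) k m\<bar> \<le> (\<Sum>j\<in>{L..k + q}. \<bar>moment 1 k j * moment l j m\<bar>)"
      by simp
    also have "\<dots> \<le> (\<Sum>j\<in>{L..k + q}. W * ?R ^ l)"
    proof (rule sum_mono)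
      fix j assume j: "j \<in> {L..k + q}"
      have "\<bar>moment 1 k j\<bar> \<le> W"
        using j k Suc.prems by (intro W) auto
      moreover have "\<bar>moment l j m\<bar> \<le> ?R ^ l"
        using j Suc.prems by (intro Suc.IH) auto
      ultimately show "\<bar>moment 1 k j * moment l j m\<bar> \<le> W * ?R ^ l"
        using W0 by (simp add: abs_mult mult_mono)
    qed
    also have "\<dots> = real (k + q + 1 - L) * (W * ?R ^ l)"
      by simp
    also have "\<dots> \<le> real (U + 1 - L) * (W * ?R ^ l)"
      using Suc.prems W0 R0 by (intro mult_right_mono) auto
    finally show ?thesis by (simp add: mult_ac)
  qed
qed

text \<open>
  The diagonal of the \<open>2 * l\<close>-th power is a full matrix product, whereas the subtracted trace only
  runs over indices below \<open>N\<close>. What survives crosses the level \<open>N\<close>, and the band structure confines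
  such index pairs to distance \<open>l * q\<close> from \<open>N\<close>.
\<close>
lemma variance_as_boundary_sum:
  "(\<Sum>k<N. moment (l + l) k k) - (\<Sum>k<N. \<Sum>m<N. moment l k m * moment l m k)
   = (\<Sum>k\<in>{N - l * q..<N}. \<Sum>m\<in>{N..<N + l * q}. moment l k m * moment l m k)"
proof -
  have "moment (l + l) k k = (\<Sum>m<N. moment l k m * moment l m k)
      + (\<Sum>m\<in>{N..<N + l * q}. moment l k m * moment l m k)" if "k < N" for k
  proof -
    have "moment (l + l) k k = (\<Sum>m<N + l * q. moment l k m * moment l m k)"
      unfolding moment_add using that by (intro sum.mono_neutral_left) (auto simp: moment_eq_0)
    also have "{..<N + l * q} = {..<N} \<union> {N..<N + l * q}" by auto
    finally show ?thesis by (simp add: sum.union_disjoint ivl_disj_int)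
  qed
  then have "(\<Sum>k<N. moment (l + l) k k) - (\<Sum>k<N. \<Sum>m<N. moment l k m * moment l m k)
      = (\<Sum>k<N. \<Sum>m\<in>{N..<N + l * q}. moment l k m * moment l m k)"
    by (simp add: sum.distrib)
  also have "\<dots> = (\<Sum>k\<in>{N - l * q..<N}. \<Sum>m\<in>{N..<N + l * q}. moment l k m * moment l m k)"
    by (intro sum.mono_neutral_right) (auto simp: moment_eq_0 intro!: sum.neutral)
  finally show ?thesis .
qed

text \<open>
  There are \<open>(l * q)\<^sup>2\<close> boundary pairs. The paths from \<open>k < N\<close> up to \<open>m \<ge> N\<close> and those back down to
  \<open>k \<ge> N - l * q\<close> all stay within distance \<open>2 * l * q\<close> of \<open>N\<close>, a window of \<open>4 * l * q + 1\<close> indices.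
\<close>
lemma boundary_sum_bound:
  assumes N: "2 * (l * q) \<le> N" and W0: "0 \<le> W"
    and W: "\<And>a b. a \<in> {N - 2 * (l * q)..N + 2 * (l * q)} \<Longrightarrow> b \<in> {N - 2 * (l * q)..N + 2 * (l * q)} \<Longrightarrow>
      \<bar>moment 1 a b\<bar> \<le> W"
  shows "(\<Sum>k\<in>{N - l * q..<N}. \<Sum>m\<in>{N..<N + l * q}. moment l k m * moment l m k)
    \<le> (real (l * q))\<^sup>2 * (real (4 * (l * q) + 1) * W) ^ (2 * l)"
proof -
  let ?R = "real (4 * (l * q) + 1) * W"
  have len: "N + 2 * (l * q) + 1 - (N - 2 * (l * q)) = 4 * (l * q) + 1" using N by simp
  have b: "\<bar>moment l k m\<bar> \<le> ?R ^ l" if "N - 2 * (l * q) + l * q \<le> m" "k + l * q \<le> N + 2 * (l * q)" for k m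
    using moment_bound[of "N - 2 * (l * q)" "N + 2 * (l * q)" W l m k] W W0 that unfolding len by auto
  have "(\<Sum>k\<in>{N - l * q..<N}. \<Sum>m\<in>{N..<N + l * q}. moment l k m * moment l m k)
      \<le> (\<Sum>k\<in>{N - l * q..<N}. \<Sum>m\<in>{N..<N + l * q}. ?R ^ l * ?R ^ l)"
  proof (intro sum_mono)
    fix k m assume km: "k \<in> {N - l * q..<N}" "m \<in> {N..<N + l * q}"
    then have "N - 2 * (l * q) + l * q \<le> m" "k + l * q \<le> N + 2 * (l * q)"
        "N - 2 * (l * q) + l * q \<le> k" "m + l * q \<le> N + 2 * (l * q)"
      using N by auto
    then have "\<bar>moment l k m\<bar> \<le> ?R ^ l" "\<bar>moment l m k\<bar> \<le> ?R ^ l"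
      using b by blast+
    then have "\<bar>moment l k m * moment l m k\<bar> \<le> ?R ^ l * ?R ^ l"
      using W0 by (simp add: abs_mult mult_mono)
    then show "moment l k m * moment l m k \<le> ?R ^ l * ?R ^ l" by simp
  qed
  also have "\<dots> = real (l * q) * (real (l * q) * (?R ^ l * ?R ^ l))"
    using N by simp
  also have "\<dots> = (real (l * q))\<^sup>2 * ?R ^ (2 * l)"
    by (simp only: power2_eq_square mult_2 power_add mult.assoc)
  finally show ?thesis .
qed

end

section \<open>Variance of the empirical moments\<close>

lemma variance_scale:
  fixes c :: real
  shows "prob_space.variance M (\<lambda>x. c * X x) = c\<^sup>2 * prob_space.variance M X"
proof -
  have "(c * X x - c * integral\<^sup>L M X)\<^sup>2 = c\<^sup>2 * (X x - integral\<^sup>L M X)\<^sup>2" for x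
    by (simp add: power_mult_distrib[symmetric] right_diff_distrib)
  then show ?thesis by simp
qed

lemma banded_restrict_to_support:
  assumes "banded_biorthogonal M P Q q"
  shows "banded_biorthogonal (restrict_to_support M P Q) P Q q"
    and "banded_biorthogonal.moment (restrict_to_support M P Q) P Q l k m = banded_biorthogonal.moment M P Q l k m"
proof -
  interpret banded_biorthogonal M P Q q by fact
  have S: "joint_support P Q \<in> sets M"
    using joint_support_measurable[OF sets_M families] .
  interpret R: banded_biorthogonal "restrict_to_support M P Q" P Q q
  proof
    show "sets (restrict_to_support M P Q) = sets borel"
      by (simp add: restrict_to_support_def sets_M)
    show "biorthogonal_families UNIV (restrict_to_support M P Q) P Q"
      by (rule biorthogonal_families_restrict[OF sets_M families])
    fix k
    obtain c where "AE x in M. x * P k x = (\<Sum>m\<le>k + q. c m * P m x)"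
      using recurrence by blast
    then have "AE x in restrict_to_support M P Q. x * P k x = (\<Sum>m\<le>k + q. c m * P m x)"
      unfolding restrict_to_support_def using S by (subst AE_density) auto
    then show "\<exists>c. AE x in restrict_to_support M P Q. x * P k x = (\<Sum>m\<le>k + q. c m * P m x)"
      by (intro exI)
  qed
  show "banded_biorthogonal (restrict_to_support M P Q) P Q q"
    by unfold_locales
  have Q: "Q m \<in> borel_measurable M"
    using L2_Q by (simp add: in_L2_def)
  show "R.moment l k m = moment l k m"
    unfolding R.moment_def moment_def unfolding restrict_to_support_def
    using S Q by (intro L2_inner_restrict borel_measurable_times measurable_power_P)
      (auto simp: joint_support_def)
qed

lemma power_sum_variance:
  assumes ens: "biorthogonal_ensemble N M P Q" and band: "banded_biorthogonal M P Q q"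
  shows "in_L2 (ensemble_law N M P Q) (\<lambda>x. \<Sum>a<N. x a ^ l)"
    and "prob_space.variance (ensemble_law N M P Q) (\<lambda>x. \<Sum>a<N. x a ^ l)
      = (\<Sum>k\<in>{N - l * q..<N}. \<Sum>m\<in>{N..<N + l * q}.
           banded_biorthogonal.moment M P Q l k m * banded_biorthogonal.moment M P Q l m k)"
proof -
  interpret M: banded_biorthogonal M P Q q by fact
  let ?R = "restrict_to_support M P Q"
  interpret R: banded_biorthogonal ?R P Q q
    by (rule banded_restrict_to_support[OF band])
  have law: "ensemble_law N ?R P Q = ensemble_law N M P Q"
    by (rule ensemble_restrict_to_support[OF ens M.families])
  interpret sigma_finite_measure ?R
    by (rule sigma_finite_restrict_to_support[OF M.sets_M M.families])
  interpret E: sigma_finite_ensemble ?R N P Q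
  proof (intro sigma_finite_ensemble.intro sigma_finite_ensemble_axioms.intro)
    show "sigma_finite_measure ?R" by unfold_locales
    show "sets ?R = sets borel" by (rule R.sets_M)
    show "biorthogonal_families {..<N} ?R P Q"
      using R.families by (auto simp: biorthogonal_families_def)
    show "AE x in PiM {..<N} (\<lambda>_. ?R). 0 \<le> ensemble_density N P Q x"
      by (rule ensemble_restrict_to_support[OF ens M.families])
    show "prob_space (ensemble_law N ?R P Q)"
      using ens law by (simp add: biorthogonal_ensemble_def)
  qed
  have sq: "(t ^ l)\<^sup>2 = t ^ (l + l)" for t :: real
    by (simp add: power2_eq_square power_add)
  note v = E.linear_statistic_variance[of "\<lambda>t. t ^ l", unfolded sq, OF _ R.integrable_power_PQ R.integrable_power_PQ]
  show "in_L2 (ensemble_law N M P Q) (\<lambda>x. \<Sum>a<N. x a ^ l)"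
    using v(1) unfolding law by simp
  have "prob_space.variance (ensemble_law N M P Q) (\<lambda>x. \<Sum>a<N. x a ^ l)
      = (\<Sum>k<N. R.moment (l + l) k k) - (\<Sum>k<N. \<Sum>m<N. R.moment l k m * R.moment l m k)"
    using v(2) unfolding law R.moment_integral by simp
  then show "prob_space.variance (ensemble_law N M P Q) (\<lambda>x. \<Sum>a<N. x a ^ l)
      = (\<Sum>k\<in>{N - l * q..<N}. \<Sum>m\<in>{N..<N + l * q}. M.moment l k m * M.moment l m k)"
    unfolding banded_restrict_to_support(2)[OF band] M.variance_as_boundary_sum .
qed

lemma finite_window:
  assumes "N \<ge> 1"
  shows "finite {k. \<bar>real k / real N - 1\<bar> \<le> \<epsilon>}"
proof -
  have "{k. \<bar>real k / real N - 1\<bar> \<le> \<epsilon>} \<subseteq> {..nat \<lceil>(1 + \<epsilon>) * real N\<rceil>}"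
  proof
    fix k assume "k \<in> {k. \<bar>real k / real N - 1\<bar> \<le> \<epsilon>}"
    then have "real k / real N \<le> 1 + \<epsilon>" by auto
    then have "real k \<le> (1 + \<epsilon>) * real N" using assms by (simp add: field_simps)
    then show "k \<in> {..nat \<lceil>(1 + \<epsilon>) * real N\<rceil>}" by (simp add: le_nat_iff) linarith
  qed
  then show ?thesis by (rule finite_subset) simp
qed

lemma window_max_upper:
  assumes "N \<ge> 1" "\<bar>real k / real N - 1\<bar> \<le> \<epsilon>" "\<bar>real m / real N - 1\<bar> \<le> \<epsilon>"
  shows "\<bar>L2_inner M (\<lambda>x. x * P k x) (Q m)\<bar> \<le> window_max \<epsilon> N M P Q"
  unfolding window_max_def
proof (rule Max_ge)
  let ?K = "{k. \<bar>real k / real N - 1\<bar> \<le> \<epsilon>}"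
  have "{\<bar>L2_inner M (\<lambda>x. x * P k x) (Q m)\<bar> | k m.
            \<bar>real k / real N - 1\<bar> \<le> \<epsilon> \<and> \<bar>real m / real N - 1\<bar> \<le> \<epsilon>}
      = (\<lambda>(k, m). \<bar>L2_inner M (\<lambda>x. x * P k x) (Q m)\<bar>) ` (?K \<times> ?K)"
    by auto
  also have "finite \<dots>"
    using finite_window[OF assms(1)] by simp
  finally show "finite {\<bar>L2_inner M (\<lambda>x. x * P k x) (Q m)\<bar> | k m.
            \<bar>real k / real N - 1\<bar> \<le> \<epsilon> \<and> \<bar>real m / real N - 1\<bar> \<le> \<epsilon>}" .
qed (use assms in blast)

lemma window_max_nonneg:
  assumes "N \<ge> 1" "\<epsilon> > 0"
  shows "0 \<le> window_max \<epsilon> N M P Q"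
  using window_max_upper[of N N \<epsilon> N M P Q] assms by (intro order_trans[OF abs_ge_zero]) auto

text \<open>
  The quantitative estimate for a single \<open>N\<close>. The minimum with \<open>1\<close> serves two purposes: the window
  of radius \<open>2 * l * q\<close> around \<open>N\<close> has to fit both into the range covered by \<open>window_max\<close> and into
  the natural numbers.
\<close>
lemma empirical_moment_variance:
  assumes ens: "biorthogonal_ensemble N M P Q" and band: "banded_biorthogonal M P Q q"
    and N: "N \<ge> 1" and eps: "\<epsilon> > 0"
  shows "in_L2 (ensemble_law N M P Q) (empirical_moment N l)"
    and "2 * (real l * real q) \<le> min \<epsilon> 1 * real N \<Longrightarrow>
      prob_space.variance (ensemble_law N M P Q) (empirical_moment N l)
      \<le> (real l * real q)\<^sup>2 * ((4 * (real l * real q) + 1) * window_max \<epsilon> N M P Q) ^ (2 * l) / (real N)\<^sup>2"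
proof -
  interpret banded_biorthogonal M P Q q by fact
  let ?W = "window_max \<epsilon> N M P Q"
  have eq: "empirical_moment N l = (\<lambda>x. (1 / real N) * (\<Sum>a<N. x a ^ l))"
    using empirical_moment_eq[OF N] by auto
  show "in_L2 (ensemble_law N M P Q) (empirical_moment N l)"
    unfolding eq by (intro in_L2_scale power_sum_variance(1)[OF ens band])
  assume small: "2 * (real l * real q) \<le> min \<epsilon> 1 * real N"
  have e: "min \<epsilon> 1 * real N \<le> \<epsilon> * real N" "min \<epsilon> 1 * real N \<le> 1 * real N"
    by (intro mult_right_mono; simp)+
  have "real (2 * (l * q)) \<le> real N" using small e by simp
  then have N2: "2 * (l * q) \<le> N" by (simp only: of_nat_le_iff)
  have near: "\<bar>real a / real N - 1\<bar> \<le> \<epsilon>" if "a \<in> {N - 2 * (l * q)..N + 2 * (l * q)}" for a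
  proof -
    have "real N \<le> real (a + 2 * (l * q))" "real a \<le> real (N + 2 * (l * q))"
      using that N2 by (simp_all only: of_nat_le_iff) auto
    then have "\<bar>real a - real N\<bar> \<le> \<epsilon> * real N"
      using small e by auto
    moreover have "real a / real N - 1 = (real a - real N) / real N"
      using N by (simp add: field_simps)
    ultimately show ?thesis
      using N by (simp add: field_simps)
  qed
  have "prob_space.variance (ensemble_law N M P Q) (\<lambda>x. \<Sum>a<N. x a ^ l)
      \<le> (real (l * q))\<^sup>2 * (real (4 * (l * q) + 1) * ?W) ^ (2 * l)"
    unfolding power_sum_variance(2)[OF ens band]
    using near window_max_upper[OF N, of _ \<epsilon>] window_max_nonneg[OF N eps] N2
    by (intro boundary_sum_bound) (auto simp: moment_def)
  moreover have "real (l * q) = real l * real q" "real (4 * (l * q) + 1) = 4 * (real l * real q) + 1"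
    by simp_all
  ultimately have "prob_space.variance (ensemble_law N M P Q) (\<lambda>x. \<Sum>a<N. x a ^ l)
      \<le> (real l * real q)\<^sup>2 * ((4 * (real l * real q) + 1) * ?W) ^ (2 * l)"
    by (simp only:)
  then have "prob_space.variance (ensemble_law N M P Q) (\<lambda>x. \<Sum>a<N. x a ^ l) / (real N)\<^sup>2
      \<le> (real l * real q)\<^sup>2 * ((4 * (real l * real q) + 1) * ?W) ^ (2 * l) / (real N)\<^sup>2"
    by (rule divide_right_mono) simp
  then show "prob_space.variance (ensemble_law N M P Q) (empirical_moment N l)
      \<le> (real l * real q)\<^sup>2 * ((4 * (real l * real q) + 1) * ?W) ^ (2 * l) / (real N)\<^sup>2"
    unfolding eq variance_scale by (simp add: power_divide)
qed

section \<open>Asymptotics\<close>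

text \<open>
  The finitely many exceptional \<open>N\<close> are absorbed into the constant, which is legitimate because the
  variance is a real number for each of them.
\<close>
lemma uniform_constant_from_eventual_bound:
  fixes v d :: "nat \<Rightarrow> real"
  assumes "eventually (\<lambda>N. v N \<le> C / d N) sequentially" "\<And>N. N \<ge> 1 \<Longrightarrow> d N > 0"
  shows "\<exists>C'. \<forall>N\<ge>1. v N \<le> C' / d N"
proof -
  obtain N0 where N0: "\<And>N. N \<ge> N0 \<Longrightarrow> v N \<le> C / d N"
    using assms(1) by (auto simp: eventually_sequentially)
  let ?A = "insert C ((\<lambda>N. v N * d N) ` {1..N0})"
  have "v N \<le> Max ?A / d N" if "N \<ge> 1" for N
  proof -
    have "v N * d N \<le> Max ?A"
    proof (cases "N \<ge> N0")
      case True
      then have "v N * d N \<le> C" using N0[of N] assms(2)[OF that] by (simp add: field_simps)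
      also have "C \<le> Max ?A" by (intro Max_ge) auto
      finally show ?thesis .
    next
      case False
      then show ?thesis using that by (intro Max_ge) auto
    qed
    then show ?thesis using assms(2)[OF that] by (simp add: field_simps)
  qed
  then show ?thesis by blast
qed

lemma eventually_le_root:
  assumes "f \<in> o(\<lambda>N. real N powr r)"
  shows "eventually (\<lambda>N. f N \<le> real N powr r) sequentially"
proof -
  have "eventually (\<lambda>N. norm (f N) \<le> 1 * norm (real N powr r)) sequentially"
    using assms by (rule landau_o.smallD) simp
  then show ?thesis by eventually_elim auto
qed

theorem theorem1p7:
  fixes \<mu> :: "nat \<Rightarrow> real measure"
    and P Q :: "nat \<Rightarrow> nat \<Rightarrow> real \<Rightarrow> real"
    and q :: "nat \<Rightarrow> nat"
    and \<epsilon> :: real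
  assumes ensemble: "\<And>N. N \<ge> 1 \<Longrightarrow> biorthogonal_ensemble N (\<mu> N) (P N) (Q N)"
    and struct: "structural_assumption \<mu> P Q q"
    and eps: "\<epsilon> > 0"
    and window: "\<And>n::nat. n \<ge> 1 \<Longrightarrow>
      (\<lambda>N. window_max \<epsilon> N (\<mu> N) (P N) (Q N)) \<in> o(\<lambda>N. real N powr (1 / real n))"
  shows "(\<forall>\<alpha>::real. 0 < \<alpha> \<and> \<alpha> < 1 \<longrightarrow> (\<forall>l::nat. \<exists>C::real. \<forall>N\<ge>1.
            has_variance_le (ensemble_law N (\<mu> N) (P N) (Q N)) (empirical_moment N l)
              (C / real N powr (1 + \<alpha>)))) \<and>
         (bounded ((\<lambda>N. real (q N)) ` {1..}) \<and> bounded ((\<lambda>N. window_max \<epsilon> N (\<mu> N) (P N) (Q N)) ` {1..}) \<longrightarrow>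
           (\<forall>l::nat. \<exists>C::real. \<forall>N\<ge>1.
            has_variance_le (ensemble_law N (\<mu> N) (P N) (Q N)) (empirical_moment N l)
              (C / real N ^ 2)))"
proof -
  define W where "W N = window_max \<epsilon> N (\<mu> N) (P N) (Q N)" for N
  define v where "v l N = prob_space.variance (ensemble_law N (\<mu> N) (P N) (Q N)) (empirical_moment N l)" for l N
  have band: "banded_biorthogonal (\<mu> N) (P N) (Q N) (q N)" if "N \<ge> 1" for N
    using ensemble[OF that] struct that
    by (auto simp: biorthogonal_ensemble_def structural_assumption_def banded_biorthogonal_def)
  have L2: "in_L2 (ensemble_law N (\<mu> N) (P N) (Q N)) (empirical_moment N l)" if "N \<ge> 1" for N l
    using empirical_moment_variance(1)[OF ensemble[OF that] band[OF that] that eps] .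
  have W0: "0 \<le> W N" if "N \<ge> 1" for N
    unfolding W_def by (rule window_max_nonneg[OF that eps])
  have q_small: "(\<lambda>N. real (q N)) \<in> o(\<lambda>N. real N powr (1 / real n))" if "n \<ge> 1" for n :: nat
    using struct that by (simp add: structural_assumption_def)
  have bound: "eventually (\<lambda>N. v l N \<le> (real l * real (q N))\<^sup>2 *
      ((4 * (real l * real (q N)) + 1) * W N) ^ (2 * l) / (real N)\<^sup>2) sequentially" for l
  proof -
    \<comment> \<open>Sublinear growth of \<open>q\<close> makes the window fit eventually; the \<open>+ 1\<close> keeps the constant
      meaningful for \<open>l = 0\<close>.\<close>
    have "eventually (\<lambda>N. norm (real (q N)) \<le> (min \<epsilon> 1 / (2 * real l + 1)) * norm (real N powr (1 / real (Suc 0)))) sequentially"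
      using q_small[of "Suc 0"] eps by (intro landau_o.smallD) auto
    then show ?thesis
      using eventually_ge_at_top[of 1]
    proof eventually_elim
      case (elim N)
      then have "real (q N) \<le> (min \<epsilon> 1 / (2 * real l + 1)) * real N" by simp
      then have "(2 * real l + 1) * real (q N) \<le> min \<epsilon> 1 * real N"
        by (simp add: field_simps)
      then have "2 * (real l * real (q N)) \<le> min \<epsilon> 1 * real N"
        by (simp add: algebra_simps)
      then show ?case
        unfolding v_def W_def
        using empirical_moment_variance(2)[OF ensemble band _ eps] elim by simp
    qed
  qed
  have conclude: "\<exists>C. \<forall>N\<ge>1. has_variance_le (ensemble_law N (\<mu> N) (P N) (Q N)) (empirical_moment N l) (C / d N)"
    if "eventually (\<lambda>N. v l N \<le> C / d N) sequentially" "\<And>N. N \<ge> 1 \<Longrightarrow> d N > 0" for l C d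
    using uniform_constant_from_eventual_bound[OF that] L2 by (simp add: has_variance_le_def v_def)
  have part1: "\<exists>C::real. \<forall>N\<ge>1. has_variance_le (ensemble_law N (\<mu> N) (P N) (Q N)) (empirical_moment N l)
      (C / real N powr (1 + \<alpha>))" if \<alpha>: "0 < \<alpha>" "\<alpha> < 1" for \<alpha> :: real and l :: nat
  proof -
    \<comment> \<open>With \<open>q\<close> and \<open>W\<close> both below \<open>N powr (1 / n)\<close> the bound has order
      \<open>N powr ((4 * l + 2) / n)\<close>, since it is of degree \<open>2 * l + 2\<close> in \<open>q\<close> and \<open>2 * l\<close> in \<open>W\<close>.
      This fixes \<open>n\<close>.\<close>
    obtain n :: nat where n: "real (4 * l + 2) / (1 - \<alpha>) < real n"
      using reals_Archimedean2 by blast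
    have "0 < real (4 * l + 2) / (1 - \<alpha>)" using \<alpha> by (intro divide_pos_pos) auto
    then have n1: "n \<ge> 1" using n by linarith
    have exponent: "real (4 * l + 2) * (1 / real n) \<le> 1 - \<alpha>"
      using n n1 \<alpha> by (simp add: field_simps)
    let ?C = "(real l)\<^sup>2 * (4 * real l + 1) ^ (2 * l)"
    have "eventually (\<lambda>N. v l N \<le> ?C / real N powr (1 + \<alpha>)) sequentially"
      using bound[of l] eventually_le_root[OF q_small[OF n1]] eventually_le_root[OF window[OF n1]]
        eventually_ge_at_top[of 1]
    proof eventually_elim
      case (elim N)
      let ?x = "real N powr (1 / real n)"
      have N: "real N \<ge> 1" using elim by simp
      then have x1: "1 \<le> ?x" by (simp add: ge_one_powr_ge_zero)
      have "4 * (real l * real (q N)) + 1 \<le> 4 * (real l * ?x) + ?x"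
        using elim(2) x1 by (intro add_mono mult_left_mono) auto
      then have "(4 * (real l * real (q N)) + 1) * W N \<le> (4 * (real l * ?x) + ?x) * ?x"
        using elim(3) W0[of N] elim(4) x1 unfolding W_def[symmetric] by (intro mult_mono) auto
      then have "((4 * (real l * real (q N)) + 1) * W N) ^ (2 * l) \<le> ((4 * (real l * ?x) + ?x) * ?x) ^ (2 * l)"
        using W0[of N] elim(4) by (intro power_mono) auto
      moreover have "(real l * real (q N))\<^sup>2 \<le> (real l * ?x)\<^sup>2"
        using elim(2) by (intro power_mono mult_left_mono) auto
      ultimately have "(real l * real (q N))\<^sup>2 * ((4 * (real l * real (q N)) + 1) * W N) ^ (2 * l)
          \<le> (real l * ?x)\<^sup>2 * ((4 * (real l * ?x) + ?x) * ?x) ^ (2 * l)"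
        using W0[of N] elim(4) by (intro mult_mono) auto
      also have "(4 * (real l * ?x) + ?x) * ?x = (4 * real l + 1) * ?x ^ 2"
        by (simp add: algebra_simps power2_eq_square)
      also have "(real l * ?x)\<^sup>2 * ((4 * real l + 1) * ?x ^ 2) ^ (2 * l) = ?C * ?x ^ (4 * l + 2)"
      proof -
        have "?x ^ (4 * l + 2) = (?x ^ 2) ^ (2 * l) * ?x ^ 2"
          by (simp only: power_mult[symmetric] power_add[symmetric]) (simp add: mult_ac)
        then show ?thesis by (simp only: power_mult_distrib mult_ac)
      qed
      also have "?x ^ (4 * l + 2) = real N powr (real (4 * l + 2) * (1 / real n))"
        using N by (subst powr_realpow[symmetric]) (auto simp: powr_powr mult_ac)
      also have "?C * \<dots> \<le> ?C * real N powr (1 - \<alpha>)"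
        using N exponent by (intro mult_left_mono powr_mono) auto
      finally have "v l N \<le> ?C * real N powr (1 - \<alpha>) / (real N)\<^sup>2"
        using elim(1) by (elim order_trans) (intro divide_right_mono, auto)
      also have "\<dots> = ?C / real N powr (1 + \<alpha>)"
      proof -
        have "real N powr (1 - \<alpha>) * real N powr (1 + \<alpha>) = (real N)\<^sup>2"
          using N by (simp add: powr_add[symmetric] powr_numeral)
        then show ?thesis using N by (simp add: field_simps)
      qed
      finally show ?case .
    qed
    then show ?thesis using conclude by simp
  qed
  have part2: "\<exists>C::real. \<forall>N\<ge>1. has_variance_le (ensemble_law N (\<mu> N) (P N) (Q N)) (empirical_moment N l)
      (C / real N ^ 2)"
    if b: "bounded ((\<lambda>N. real (q N)) ` {1..})" "bounded (W ` {1..})" for l :: nat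
  proof -
    obtain A where "\<forall>y\<in>(\<lambda>N. real (q N)) ` {1..}. \<bar>y\<bar> \<le> A"
      using b(1) unfolding bounded_real by blast
    then have A: "real (q N) \<le> A" if "N \<ge> 1" for N
      using that by simp
    obtain B where "\<forall>y\<in>W ` {1..}. \<bar>y\<bar> \<le> B"
      using b(2) unfolding bounded_real by blast
    then have B: "W N \<le> B" if "N \<ge> 1" for N
      using that by (auto simp: abs_le_iff)
    let ?C = "(real l * A)\<^sup>2 * ((4 * (real l * A) + 1) * B) ^ (2 * l)"
    have "eventually (\<lambda>N. v l N \<le> ?C / (real N)\<^sup>2) sequentially"
      using bound[of l] eventually_ge_at_top[of 1]
    proof eventually_elim
      case (elim N)
      have "0 \<le> real (q N)" by simp
      then have A0: "0 \<le> A" using A[OF elim(2)] by linarith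
      have "(real l * real (q N))\<^sup>2 * ((4 * (real l * real (q N)) + 1) * W N) ^ (2 * l) \<le> ?C"
        using A[OF elim(2)] B[OF elim(2)] W0[OF elim(2)] A0
        by (intro mult_mono power_mono add_mono mult_left_mono) auto
      then show ?case
        using elim(1) by (elim order_trans) (intro divide_right_mono, auto)
    qed
    then show ?thesis using conclude by simp
  qed
  show ?thesis
    using part1 part2 unfolding W_def by blast
qed

end
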